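(* Let $\Lambda$ be a lattice of determinant $1$ in $\mathbb R^n$, let $k$ be a natural number (with $k\ge 2$ if $n=1$), and let $V$ be the set of $k$-free points of $\Lambda$. Then the patch-counting entropy of $V$ is $$h_{\rm pc}(V)=\frac{1}{\zeta(nk)},$$ where $\zeta$ is the Riemann zeta function.
   Context: For a nonzero point $l\in\Lambda$, the $k$-content $c_k(l)$ is the largest integer $c$ such that $l\in c^k\Lambda$; $c_k(0)=\infty$. The set of $k$-free points is $V=\{l\in\Lambda: c_k(l)=1\}$. $B_\rho(x)$ is the open Euclidean ball of radius $\rho$ about $x$, and $v_n$ is the volume of the unit ball in $\mathbb R^n$. For $\rho>0$ and $t\in\Lambda$ the $\rho$-patch of $V$ at $t$ is $(V-t)\cap B_\rho(0)$. Let $N(\rho)$ be the number of distinct $\rho$-patches of $V$ (as $t$ ranges over $\Lambda$). The patch-counting entropy is $$h_{\rm pc}(V):=\lim_{\rho\to\infty}\frac{\log_2 N(\rho)}{\rho^n v_n}.$$ *)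

theory Defs
  imports "HOL-Analysis.Analysis"
begin

text \<open>The columns of \<open>B\<close> form a \<open>\<int>\<close>-basis of the full-rank lattice \<open>L\<close>.\<close>

definition lattice_basis :: "real ^ 'n ^ 'n \<Rightarrow> (real ^ 'n) set \<Rightarrow> bool" where
  "lattice_basis B L \<longleftrightarrow> invertible B \<and> L = {B *v z |z. \<forall>i. z $ i \<in> \<int>}"

definition is_lattice :: "(real ^ 'n) set \<Rightarrow> bool" where
  "is_lattice L \<longleftrightarrow> (\<exists>B. lattice_basis B L)"

text \<open>The choice of basis does not matter, see \<open>lattice_det_eq\<close> below.\<close>

definition lattice_det :: "(real ^ 'n) set \<Rightarrow> real" where
  "lattice_det L = \<bar>det (SOME B. lattice_basis B L)\<bar>"

lemma lattice_basis_change: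
  assumes "lattice_basis B L" "lattice_basis C L"
  shows "\<exists>U. B = C ** U \<and> det U \<in> \<int>"
proof -
  have "\<exists>z. column j B = C *v z \<and> (\<forall>i. z $ i \<in> \<int>)" for j
  proof -
    have "\<forall>i. axis j (1::real) $ i \<in> \<int>"
      by (simp add: axis_def)
    then have "B *v axis j 1 \<in> L"
      using assms(1) unfolding lattice_basis_def by blast
    then show ?thesis
      using assms(2) unfolding lattice_basis_def matrix_vector_mult_basis by blast
  qed
  then obtain u where u: "\<And>j. column j B = C *v u j" "\<And>j i. u j $ i \<in> \<int>"
    by metis
  define U where "U = (\<chi> i j. u j $ i)"
  have "column j (C ** U) = C *v u j" for j
    by (simp add: vec_eq_iff column_def matrix_matrix_mult_def matrix_vector_mult_def U_def)
  with u(1) have "B = C ** U"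
    by (simp add: vec_eq_iff column_def)
  moreover have "det U \<in> \<int>"
    unfolding det_def U_def by (auto intro!: Ints_sum Ints_mult Ints_prod simp: u(2))
  ultimately show ?thesis
    by blast
qed

lemma lattice_det_eq:
  assumes "lattice_basis B L"
  shows "lattice_det L = \<bar>det B\<bar>"
proof -
  define C where "C = (SOME C. lattice_basis C L)"
  have C: "lattice_basis C L"
    unfolding C_def using assms by (rule someI)
  obtain U where U: "B = C ** U" "det U \<in> \<int>"
    using lattice_basis_change[OF assms C] by blast
  obtain W where W: "C = B ** W" "det W \<in> \<int>"
    using lattice_basis_change[OF C assms] by blast
  have nz: "det B \<noteq> 0"
    using assms by (simp add: lattice_basis_def invertible_det_nz)
  have detB: "det B = det C * det U"
    by (subst U(1)) (rule det_mul)
  have detC: "det C = det B * det W"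
    by (subst W(1)) (rule det_mul)
  obtain a b where ab: "det W = of_int a" "det U = of_int b"
    using U(2) W(2) by (auto elim!: Ints_cases)
  have "det B * (of_int a * of_int b) = det B * 1"
    using detB unfolding detC ab by (simp only: mult.assoc mult_1_right)
  then have "real_of_int (a * b) = 1"
    using nz by (simp only: mult_cancel_left of_int_mult) simp
  then have "a * b = 1"
    by linarith
  then have "\<bar>a\<bar> = 1"
    by (auto simp: zmult_eq_1_iff)
  then have "\<bar>det W\<bar> = 1"
    unfolding ab by linarith
  then have "\<bar>det C\<bar> = \<bar>det B\<bar>"
    unfolding detC abs_mult by simp
  then show ?thesis
    by (simp add: lattice_det_def C_def)
qed

text \<open>
  For \<open>k \<ge> 1\<close> and \<open>x \<in> L - {0}\<close> the maximum exists, as \<open>c = 1\<close> qualifies and \<open>L\<close> is discrete.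
\<close>

definition k_content :: "nat \<Rightarrow> (real ^ 'n) set \<Rightarrow> real ^ 'n \<Rightarrow> enat" where
  "k_content k L x =
     (if x = 0 then \<infinity> else enat (GREATEST c::nat. x \<in> (\<lambda>y. real c ^ k *\<^sub>R y) ` L))"

definition k_free_points :: "nat \<Rightarrow> (real ^ 'n) set \<Rightarrow> (real ^ 'n) set" where
  "k_free_points k L = {x \<in> L. k_content k L x = 1}"

definition patch :: "(real ^ 'n) set \<Rightarrow> real \<Rightarrow> real ^ 'n \<Rightarrow> (real ^ 'n) set" where
  "patch V \<rho> t = (\<lambda>x. x - t) ` V \<inter> ball 0 \<rho>"

definition patch_count :: "(real ^ 'n) set \<Rightarrow> (real ^ 'n) set \<Rightarrow> real \<Rightarrow> nat" where
  "patch_count L V \<rho> = card (patch V \<rho> ` L)"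

definition patch_rate :: "(real ^ 'n) set \<Rightarrow> (real ^ 'n) set \<Rightarrow> real \<Rightarrow> real" where
  "patch_rate L V \<rho> =
     log 2 (real (patch_count L V \<rho>)) / (\<rho> ^ CARD('n) * measure lborel (ball (0 :: real ^ 'n) 1))"

definition pc_entropy :: "(real ^ 'n) set \<Rightarrow> (real ^ 'n) set \<Rightarrow> real" where
  "pc_entropy L V = Lim at_top (patch_rate L V)"

text \<open>The Riemann zeta function, restricted to real arguments \<open>s > 1\<close>.\<close>

definition riemann_zeta :: "real \<Rightarrow> real" where
  "riemann_zeta s = (\<Sum>m. 1 / real (Suc m) powr s)"

end

theory Submission
  imports Defs "HOL-Number_Theory.Number_Theory"
begin

text \<open>
  A point is \<open>k\<close>-free iff it avoids \<open>p\<^sup>k\<Lambda>\<close> for all primes \<open>p\<close>. For a finite set \<open>F\<close> of primes, the points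
  avoiding \<open>p\<^sup>k\<Lambda>\<close> for \<open>p \<in> F\<close> have density \<open>\<Prod>p\<in>F. 1 - 1/p\<^bsup>nk\<^esup>\<close> in balls of radius \<open>\<rho>\<close>, uniformly in the
  centre, by induction on \<open>F\<close>: adding a prime removes a copy of the previous set dilated by \<open>p\<^sup>k\<close>.

  Upper bound: each \<open>\<rho>\<close>-patch is contained in the patch of this periodic set at the same centre,
  and the latter has only finitely many translates, so \<open>log\<^sub>2 N(\<rho>)\<close> is at most the number of its
  points in a \<open>\<rho>\<close>-ball plus a constant.

  Lower bound: every subset of \<open>V \<inter> B\<^sub>\<rho>(0)\<close> is a \<open>\<rho>\<close>-patch, by the Chinese remainder theorem and a sieve, so
  \<open>log\<^sub>2 N(\<rho>)\<close> is at least the number of points of \<open>V\<close> in that ball. By the Euler product, both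
  bounds have density \<open>1/\<zeta>(nk)\<close> in the limit.
\<close>

subsection \<open>Volume of linear images\<close>

text \<open>\<open>measure_shear_interval\<close> asks for a nonempty box whose lower corner is
  nonnegative in coordinate \<open>n\<close>. Since \<open>h\<close> is additive and volume is
  translation invariant, the box can be moved to the origin.\<close>

lemma measure_shear:
  fixes a b :: "real ^ 'n"
  assumes "m \<noteq> n"
  defines "h \<equiv> \<lambda>x :: real ^ 'n. \<chi> i. if i = m then x $ m + x $ n else x $ i"
  shows "measure lebesgue (h ` cbox a b) = measure lebesgue (cbox a b)"
proof (cases "cbox a b = {}")
  case False
  have "h ` cbox a b = h ` (+) a ` cbox 0 (b - a)"
    by (simp flip: cbox_translation)
  also have "\<dots> = (+) (h a) ` h ` cbox 0 (b - a)"
    unfolding image_image by (rule image_cong) (auto simp: h_def vec_eq_iff)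
  finally have "measure lebesgue (h ` cbox a b) = measure lebesgue (h ` cbox 0 (b - a))"
    by (simp only: measure_translation)
  also have "\<dots> = measure lebesgue (cbox 0 (b - a))"
    unfolding h_def using False by (intro measure_shear_interval assms) (auto simp: interval_ne_empty_cart)
  also have "\<dots> = measure lebesgue ((+) a ` cbox 0 (b - a))"
    by (simp only: measure_translation)
  also have "(+) a ` cbox 0 (b - a) = cbox a b"
    by (simp flip: cbox_translation)
  finally show ?thesis .
qed simp

text \<open>
  The library has this only for index types of class \<open>wellorder\<close>, where the determinant of a
  shear is that of a triangular matrix; row operations give it in general.
\<close>

lemma
  fixes f :: "real ^ 'n \<Rightarrow> real ^ 'n"
  assumes "linear f" "S \<in> lmeasurable"
  shows lmeasurable_linear_image_cart: "f ` S \<in> lmeasurable"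
    and measure_linear_image_cart:
      "measure lebesgue (f ` S) = \<bar>det (matrix f)\<bar> * measure lebesgue S"
proof -
  \<comment> \<open>Quantifying over all measurable sets makes \<open>P\<close> stable under
    composition, as the induction over elementary maps demands.\<close>
  define P where "P f \<longleftrightarrow> (\<forall>S\<in>lmeasurable. f ` S \<in> lmeasurable \<and>
    measure lebesgue (f ` S) = \<bar>det (matrix f)\<bar> * measure lebesgue S)" for f :: "real ^ 'n \<Rightarrow> real ^ 'n"
  \<comment> \<open>For determinant \<plusminus>1 it is enough to compare volumes of boxes; this
    serves the coordinate swaps and the shears.\<close>
  have P_intervals: "P h" if "linear h" "\<bar>det (matrix h)\<bar> = 1"
      "\<And>a b. measure lebesgue (h ` cbox a b) = measure lebesgue (cbox a b)" for h
    unfolding P_def that(2)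
  proof
    fix S :: "(real ^ 'n) set" assume "S \<in> lmeasurable"
    from measure_linear_sufficient[OF that(1) this, of 1] that(3)
    show "h ` S \<in> lmeasurable \<and> measure lebesgue (h ` S) = 1 * measure lebesgue S"
      by (metis mult_1)
  qed
  have "P f"
    using assms(1)
  proof (rule induct_linear_elementary)
    fix f g :: "real ^ 'n \<Rightarrow> real ^ 'n"
    assume "linear f" "linear g" and "P f" "P g"
    then show "P (f \<circ> g)"
      unfolding P_def image_comp[symmetric] by (simp add: matrix_compose det_mul abs_mult)
  next
    fix f :: "real ^ 'n \<Rightarrow> real ^ 'n" and i assume f: "linear f" "\<And>x. f x $ i = 0"
    have "\<not> surj f"
    proof
      assume "surj f"
      then obtain x where "f x = axis i 1"
        by (metis surjD)
      with f(2)[of x] show False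
        by simp
    qed
    then have "\<not> inj f"
      using f(1) linear_injective_imp_surjective by blast
    then have "negligible (f ` S)" for S
      using f(1) negligible_linear_singular_image by blast
    moreover have "det (matrix f) = 0"
      using det_nz_iff_inj[OF f(1)] \<open>\<not> inj f\<close> by blast
    ultimately show "P f"
      by (simp add: P_def negligible_iff_measure)
  next
    fix c :: "'n \<Rightarrow> real"
    have "matrix (\<lambda>x :: real ^ 'n. \<chi> i. c i * x $ i) = (\<chi> i j. if i = j then c i else 0)"
      by (simp add: matrix_def axis_def vec_eq_iff)
    then have "det (matrix (\<lambda>x :: real ^ 'n. \<chi> i. c i * x $ i)) = prod c UNIV"
      by (simp add: det_diagonal)
    then show "P (\<lambda>x. \<chi> i. c i * x $ i)"
      by (simp add: P_def measurable_stretch measure_stretch)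
  next
    fix m n :: 'n assume "m \<noteq> n"
    define \<tau> where "\<tau> = Transposition.transpose m n"
    define h where "h = (\<lambda>x :: real ^ 'n. \<chi> i. x $ \<tau> i)"
    have \<tau>: "\<tau> permutes UNIV" "\<And>i. \<tau> (\<tau> i) = i"
      by (simp_all add: \<tau>_def permutes_swap_id)
    have "matrix h = (\<chi> i. (mat 1 :: real ^ 'n ^ 'n) $ \<tau> i)"
      by (simp add: matrix_def h_def axis_def mat_def vec_eq_iff)
    then have det: "\<bar>det (matrix h)\<bar> = 1"
      using det_permute_rows[OF \<tau>(1), of "mat 1 :: real ^ 'n ^ 'n"] by (simp add: abs_mult sign_def)
    have "measure lebesgue (h ` cbox a b) = measure lebesgue (cbox a b)" for a b
    proof -
      have image: "h ` cbox a b = cbox (h a) (h b)"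
      proof
        show "cbox (h a) (h b) \<subseteq> h ` cbox a b"
        proof
          fix y assume y: "y \<in> cbox (h a) (h b)"
          have "h y \<in> cbox a b"
            unfolding mem_box_cart h_def
          proof
            fix i show "a $ i \<le> (\<chi> i. y $ \<tau> i) $ i \<and> (\<chi> i. y $ \<tau> i) $ i \<le> b $ i"
              using y[unfolded mem_box_cart, rule_format, of "\<tau> i"] by (simp add: h_def \<tau>(2))
          qed
          moreover have "h (h y) = y"
            using \<tau>(2) by (simp add: h_def vec_eq_iff)
          ultimately show "y \<in> h ` cbox a b"
            by (metis imageI)
        qed
      qed (auto simp: mem_box_cart h_def)
      show ?thesis
      proof (cases "cbox a b = {}")
        case False
        then have "cbox (h a) (h b) \<noteq> {}"
          using image by (metis image_is_empty)
        then have "measure lebesgue (cbox (h a) (h b)) = (\<Prod>i\<in>UNIV. b $ \<tau> i - a $ \<tau> i)"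
          by (simp add: measure_completion content_cbox_cart h_def)
        also have "\<dots> = (\<Prod>i\<in>UNIV. b $ i - a $ i)"
          using prod.permute[OF \<tau>(1), of "\<lambda>i. b $ i - a $ i"] by (simp add: o_def)
        finally show ?thesis
          using False image by (simp add: measure_completion content_cbox_cart)
      qed simp
    qed
    moreover have "linear h"
      by (rule linearI) (simp_all add: h_def vec_eq_iff)
    ultimately show "P (\<lambda>x. \<chi> i. x $ Transposition.transpose m n i)"
      using P_intervals det by (simp add: h_def \<tau>_def)
  next
    fix m n :: 'n assume mn: "m \<noteq> n"
    define h where "h = (\<lambda>x :: real ^ 'n. \<chi> i. if i = m then x $ m + x $ n else x $ i)"
    have "matrix h = (\<chi> k. if k = m then row m (mat 1) + 1 *s row n (mat 1) else row k (mat 1))"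
      by (auto simp: matrix_def h_def axis_def mat_def row_def vec_eq_iff)
    then have "det (matrix h) = 1"
      using det_row_operation[OF mn, of "mat 1 :: real ^ 'n ^ 'n" 1] by simp
    moreover have "linear h"
      by (rule linearI) (auto simp: h_def vec_eq_iff algebra_simps)
    ultimately show "P (\<lambda>x. \<chi> i. if i = m then x $ m + x $ n else x $ i)"
      using P_intervals measure_shear[OF mn] by (simp add: h_def)
  qed
  then show "f ` S \<in> lmeasurable" "measure lebesgue (f ` S) = \<bar>det (matrix f)\<bar> * measure lebesgue S"
    using assms(2) by (auto simp: P_def)
qed

subsection \<open>Lattice points in balls\<close>

text \<open>Integer coordinates carry all the arithmetic; the basis matrix only decides which points
  lie in a ball.\<close>

definition lattice_point :: "real ^ 'n ^ 'n \<Rightarrow> int ^ 'n \<Rightarrow> real ^ 'n" where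
  "lattice_point B z = B *v (\<chi> i. real_of_int (z $ i))"

lemma lattice_point_add: "lattice_point B (z + w) = lattice_point B z + lattice_point B w"
proof -
  have "(\<chi> i. real_of_int ((z + w) $ i)) = (\<chi> i. real_of_int (z $ i)) + (\<chi> i. real_of_int (w $ i))"
    by (simp add: vec_eq_iff)
  then show ?thesis
    by (simp add: lattice_point_def matrix_vector_right_distrib)
qed

lemma lattice_point_scale: "lattice_point B (c *s z) = real_of_int c *\<^sub>R lattice_point B z"
proof -
  have "(\<chi> i. real_of_int ((c *s z) $ i)) = real_of_int c *\<^sub>R (\<chi> i. real_of_int (z $ i))"
    by (simp add: vec_eq_iff)
  then show ?thesis
    by (simp add: lattice_point_def matrix_vector_mult_scaleR)
qed

lemma lattice_point_zero [simp]: "lattice_point B 0 = 0"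
  using lattice_point_scale[of B 0 0] by simp

lemma lattice_point_diff: "lattice_point B (z - w) = lattice_point B z - lattice_point B w"
  using lattice_point_add[of B "z - w" w] by (simp add: algebra_simps)

lemma inj_lattice_point:
  assumes "invertible B"
  shows "inj (lattice_point B)"
proof (rule injI)
  fix z w assume "lattice_point B z = lattice_point B w"
  with inj_matrix_vector_mult[OF assms]
  have "(\<chi> i. real_of_int (z $ i)) = (\<chi> i. real_of_int (w $ i))"
    unfolding lattice_point_def by (rule injD)
  then show "z = w"
    by (simp add: vec_eq_iff)
qed

lemma lattice_basis_range:
  assumes "lattice_basis B L"
  shows "L = range (lattice_point B)"
proof -
  have "\<exists>w. z = (\<chi> i. real_of_int (w $ i))" if "\<forall>i. z $ i \<in> \<int>" for z :: "real ^ 'a"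
  proof
    show "z = (\<chi> i. real_of_int ((\<chi> i. \<lfloor>z $ i\<rfloor>) $ i))"
      using that by (simp add: vec_eq_iff)
  qed
  then show ?thesis
    using assms unfolding lattice_basis_def lattice_point_def by fastforce
qed

section \<open>Unit cells and the comparison of volumes\<close>

definition unit_cell :: "int ^ 'n \<Rightarrow> (real ^ 'n) set" where
  "unit_cell z = cbox (\<chi> i. real_of_int (z $ i)) (\<chi> i. real_of_int (z $ i) + 1)"

lemma measure_unit_cell: "measure lebesgue (unit_cell z) = 1"
  and unit_cell_lmeasurable: "unit_cell z \<in> lmeasurable"
  by (auto simp: unit_cell_def measure_completion content_cbox_cart interval_ne_empty_cart)

text \<open>Closed cells may share a face. A coordinate in which \<open>z\<close> and
  \<open>w\<close> differ keeps the interiors apart, and a convex set with empty interior is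
  negligible.\<close>

lemma negligible_unit_cells:
  assumes "z \<noteq> w"
  shows "negligible (unit_cell z \<inter> unit_cell w)"
proof -
  obtain i where i: "z $ i \<noteq> w $ i"
    using assms by (auto simp: vec_eq_iff)
  have "box (\<chi> i. real_of_int (z $ i)) (\<chi> i. real_of_int (z $ i) + 1) \<inter>
        box (\<chi> i. real_of_int (w $ i)) (\<chi> i. real_of_int (w $ i) + 1) = {}"
    using i by (auto simp: mem_box_cart dest!: spec[of _ i])
  then have "interior (unit_cell z \<inter> unit_cell w) = {}"
    by (simp add: unit_cell_def)
  moreover have "convex (unit_cell z \<inter> unit_cell w)"
    by (simp add: unit_cell_def convex_Int)
  ultimately show ?thesis
    by (metis negligible_convex_interior)
qed

text \<open>
  Each lattice point is charged with its unit cell in coordinate space; \<open>d\<close> bounds the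
  diameter of the image of a unit cell.
\<close>

proposition lattice_count_bounds:
  fixes B :: "real ^ 'n ^ 'n"
  assumes B: "invertible B"
  defines "v \<equiv> measure lborel (ball (0 :: real ^ 'n) 1)"
  obtains d where "d > 0"
    and "\<And>x r. finite {z. lattice_point B z \<in> ball x r}"
    and "\<And>x r. r \<ge> 0 \<Longrightarrow>
      real (card {z. lattice_point B z \<in> ball x r}) * \<bar>det B\<bar> \<le> v * (r + d) ^ CARD('n)"
    and "\<And>x r. r \<ge> d \<Longrightarrow>
      v * (r - d) ^ CARD('n) \<le> real (card {z. lattice_point B z \<in> ball x r}) * \<bar>det B\<bar>"
proof -
  obtain C where BC: "B ** C = mat 1" and CB: "C ** B = mat 1"
    using B by (auto simp: invertible_def)
  have BCv: "B *v (C *v w) = w" and CBv: "C *v (B *v w) = w" for w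
    by (simp_all add: matrix_vector_mul_assoc BC CB)
  have det_BC: "det B * det C = 1"
    using BC by (metis det_I det_mul)
  \<comment> \<open>\<open>D x r\<close> is the preimage of the ball under \<open>B\<close>: lattice
    points of the ball become integer points of \<open>D x r\<close>, whose volume is
    \<open>v * r ^ n / \<bar>det B\<bar>\<close> with \<open>n\<close> the dimension.\<close>
  define D where "D x r = (*v) C ` ball x r" for x r
  have D_meas: "D x r \<in> lmeasurable" for x r
    unfolding D_def by (rule lmeasurable_linear_image_cart) auto
  have D_iff: "w \<in> D x r \<longleftrightarrow> B *v w \<in> ball x r" for w x r
    unfolding D_def using BCv CBv by (metis (no_types, lifting) image_iff)
  have D_measure: "measure lebesgue (D x r) * \<bar>det B\<bar> = v * r ^ CARD('n)" if "r \<ge> 0" for x r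
  proof -
    have "measure lebesgue (D x r) = \<bar>det C\<bar> * measure lebesgue (ball x r)"
      unfolding D_def by (subst measure_linear_image_cart) auto
    also have "measure lebesgue (ball x r) = v * r ^ CARD('n)"
      using content_ball_conv_unit_ball[OF that, of x] by (simp add: v_def measure_completion)
    finally have "measure lebesgue (D x r) * \<bar>det B\<bar> = \<bar>det B * det C\<bar> * (v * r ^ CARD('n))"
      by (simp add: abs_mult)
    then show ?thesis
      by (simp add: det_BC)
  qed
  have "bounded ((*v) B ` cbox 0 (\<chi> i. 1))"
    by (intro bounded_linear_image bounded_cbox) simp
  then obtain d where d: "d > 0" "\<And>w. w \<in> cbox 0 (\<chi> i. 1) \<Longrightarrow> norm (B *v w) < d"
    by (auto simp: bounded_pos_less)
  have near: "dist (B *v w) (lattice_point B z) < d" if "w \<in> unit_cell z" for w z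
  proof -
    have "w - (\<chi> i. real_of_int (z $ i)) \<in> cbox 0 (\<chi> i. 1)"
      using that by (auto simp: unit_cell_def mem_box_cart algebra_simps)
    from d(2)[OF this] show ?thesis
      by (simp add: dist_norm lattice_point_def matrix_vector_mult_diff_distrib)
  qed
  define S where "S x r = {z. lattice_point B z \<in> ball x r}" for x r
  have cells_sub: "unit_cell z \<subseteq> D x (r + d)" if "z \<in> S x r" for z x r
  proof
    fix w assume "w \<in> unit_cell z"
    from near[OF this] that show "w \<in> D x (r + d)"
      unfolding D_iff S_def by (auto simp: dist_commute intro: dist_triangle_lt[where z = "lattice_point B z"])
  qed
  have cells_cover: "D x (r - d) \<subseteq> (\<Union>z\<in>S x r. unit_cell z)" for x r
  proof
    fix w assume w: "w \<in> D x (r - d)"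
    define z where "z = (\<chi> i. \<lfloor>w $ i\<rfloor>)"
    have z: "w \<in> unit_cell z"
      by (auto simp: unit_cell_def z_def mem_box_cart)
    have "dist x (lattice_point B z) \<le> dist x (B *v w) + dist (B *v w) (lattice_point B z)"
      by (rule dist_triangle)
    also have "\<dots> < r"
      using near[OF z] w unfolding D_iff by simp
    finally have "dist x (lattice_point B z) < r" .
    with z show "w \<in> (\<Union>z\<in>S x r. unit_cell z)"
      by (auto simp: S_def)
  qed
  have card_sub: "real (card T) * \<bar>det B\<bar> \<le> v * (r + d) ^ CARD('n)"
    if "finite T" "T \<subseteq> S x r" "r \<ge> 0" for T x r
  proof -
    have "real (card T) = (\<Sum>z\<in>T. measure lebesgue (unit_cell z))"
      by (simp add: measure_unit_cell)
    also have "\<dots> = measure lebesgue (\<Union>z\<in>T. unit_cell z)"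
      using that(1) by (subst measure_negligible_finite_Union_image)
        (auto simp: unit_cell_lmeasurable pairwise_def negligible_unit_cells)
    also have "\<dots> \<le> measure lebesgue (D x (r + d))"
      using that cells_sub by (intro measure_mono_fmeasurable D_meas fmeasurableD fmeasurable.finite_UN)
        (auto simp: unit_cell_lmeasurable subset_iff)
    finally have "real (card T) * \<bar>det B\<bar> \<le> measure lebesgue (D x (r + d)) * \<bar>det B\<bar>"
      by (intro mult_right_mono) auto
    then show ?thesis
      using D_measure that(3) d(1) by simp
  qed
  have "det B \<noteq> 0"
    using B by (simp add: invertible_det_nz)
  \<comment> \<open>Volume bounds the size of every finite subset, which forces finiteness.\<close>
  have "finite (S x r)" if "r \<ge> 0" for x r
  proof -
    have "card T \<le> nat \<lfloor>v * (r + d) ^ CARD('n) / \<bar>det B\<bar>\<rfloor>" if "T \<subseteq> S x r" "finite T" for T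
    proof -
      have "real (card T) \<le> v * (r + d) ^ CARD('n) / \<bar>det B\<bar>"
        using card_sub[OF that(2,1) \<open>r \<ge> 0\<close>] \<open>det B \<noteq> 0\<close> by (simp add: field_simps)
      then show ?thesis
        by linarith
    qed
    then show ?thesis
      using finite_if_finite_subsets_card_bdd by blast
  qed
  moreover have "S x r = {}" if "\<not> r \<ge> 0" for x r
  proof -
    have "ball x r = {}"
      using that by simp
    then show ?thesis
      by (simp only: S_def) auto
  qed
  ultimately have fin: "finite (S x r)" for x r
    by (cases "r \<ge> 0") auto
  have lower: "v * (r - d) ^ CARD('n) \<le> real (card (S x r)) * \<bar>det B\<bar>" if "r \<ge> d" for x r
  proof -
    have "measure lebesgue (D x (r - d)) \<le> measure lebesgue (\<Union>z\<in>S x r. unit_cell z)"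
      using fin by (intro measure_mono_fmeasurable cells_cover fmeasurableD D_meas fmeasurable.finite_UN)
        (auto simp: unit_cell_lmeasurable)
    also have "\<dots> \<le> (\<Sum>z\<in>S x r. measure lebesgue (unit_cell z))"
      by (intro measure_UNION_le fin) (auto simp: unit_cell_lmeasurable fmeasurableD)
    also have "\<dots> = real (card (S x r))"
      by (simp add: measure_unit_cell)
    finally have "measure lebesgue (D x (r - d)) * \<bar>det B\<bar> \<le> real (card (S x r)) * \<bar>det B\<bar>"
      by (intro mult_right_mono) auto
    then show ?thesis
      using D_measure that by simp
  qed
  show thesis
  proof (rule that[OF d(1)])
    show "finite {z. lattice_point B z \<in> ball x r}" for x r
      using fin unfolding S_def .
    show "real (card {z. lattice_point B z \<in> ball x r}) * \<bar>det B\<bar> \<le> v * (r + d) ^ CARD('n)"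
      if "r \<ge> 0" for x r
      using card_sub[OF fin order_refl that] unfolding S_def .
    show "v * (r - d) ^ CARD('n) \<le> real (card {z. lattice_point B z \<in> ball x r}) * \<bar>det B\<bar>"
      if "r \<ge> d" for x r
      using lower[OF that] unfolding S_def .
  qed
qed

subsection \<open>The Euler product\<close>

text \<open>The tail of \<zeta>(s) over the integers above \<open>P\<close>; it measures the loss
  from ignoring large primes.\<close>

definition zeta_tail :: "nat \<Rightarrow> nat \<Rightarrow> real" where
  "zeta_tail s P = (\<Sum>m. 1 / real (m + Suc P) ^ s)"

lemma summable_inverse_power:
  assumes "s \<ge> 2"
  shows "summable (\<lambda>n. 1 / real n ^ s)"
  using inverse_power_summable[OF assms, where 'a = real] by (simp add: inverse_eq_divide)

lemma zeta_tail_eq: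
  assumes "s \<ge> 2"
  shows "zeta_tail s P = (\<Sum>n. 1 / real n ^ s) - (\<Sum>n\<le>P. 1 / real n ^ s)"
  using suminf_minus_initial_segment[OF summable_inverse_power[OF assms], of "Suc P"]
  by (simp add: zeta_tail_def lessThan_Suc_atMost)

lemma zeta_tail_tendsto_0:
  assumes "s \<ge> 2"
  shows "zeta_tail s \<longlonglongrightarrow> 0"
proof -
  have "(\<lambda>P. \<Sum>n\<le>P. 1 / real n ^ s) \<longlonglongrightarrow> (\<Sum>n. 1 / real n ^ s)"
    by (rule summable_LIMSEQ'[OF summable_inverse_power[OF assms]])
  from tendsto_diff[OF tendsto_const this, of "\<Sum>n. 1 / real n ^ s"]
  have "(\<lambda>P. zeta_tail s P) \<longlonglongrightarrow> 0"
    unfolding zeta_tail_eq[OF assms] by simp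
  then show ?thesis .
qed

lemma sum_le_zeta_tail:
  assumes "s \<ge> 2" "finite A" "A \<subseteq> {P<..}"
  shows "(\<Sum>n\<in>A. 1 / real n ^ s) \<le> zeta_tail s P"
proof -
  have "(\<Sum>n\<in>A. 1 / real n ^ s) + (\<Sum>n\<le>P. 1 / real n ^ s) = (\<Sum>n\<in>A \<union> {..P}. 1 / real n ^ s)"
    using assms by (intro sum.union_disjoint[symmetric]) auto
  also have "\<dots> \<le> (\<Sum>n. 1 / real n ^ s)"
    using assms by (intro sum_le_suminf summable_inverse_power) auto
  finally show ?thesis
    by (simp add: zeta_tail_eq[OF assms(1)])
qed

lemma zeta_tail_nonneg: "s \<ge> 2 \<Longrightarrow> zeta_tail s P \<ge> 0"
  using sum_le_zeta_tail[of s "{}" P] by simp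

text \<open>The term at \<open>n = 0\<close> is \<open>1 / 0 = 0\<close>, so starting the sum there
  costs nothing.\<close>

lemma riemann_zeta_nat:
  assumes "s \<ge> 2"
  shows "riemann_zeta (real s) = (\<Sum>n. 1 / real n ^ s)"
proof -
  have "riemann_zeta (real s) = (\<Sum>m. 1 / real (Suc m) ^ s)"
    by (simp add: riemann_zeta_def powr_realpow del: of_nat_Suc)
  also have "\<dots> = (\<Sum>n. 1 / real n ^ s)"
    using suminf_split_head[OF summable_inverse_power[OF assms]] assms by simp
  finally show ?thesis .
qed

lemma riemann_zeta_pos:
  assumes "s \<ge> 2"
  shows "riemann_zeta (real s) > 0"
  unfolding riemann_zeta_nat[OF assms]
  by (rule suminf_pos2[OF summable_inverse_power[OF assms], of 1]) auto

text \<open>Each factor is one step of the sieve of Eratosthenes: the sifted terms satisfy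
  \<open>f (p * n) = f n / p ^ s\<close>, so multiplying by \<open>1 - 1 / p ^ s\<close> removes
  precisely the multiples of \<open>p\<close>.\<close>

lemma euler_product_partial:
  assumes s: "s \<ge> 2" and "finite F" "\<And>p. p \<in> F \<Longrightarrow> prime p"
  shows "(\<Prod>p\<in>F. 1 - 1 / real p ^ s) * riemann_zeta (real s) =
    (\<Sum>n. if \<forall>p\<in>F. \<not> p dvd n then 1 / real n ^ s else 0)"
  using assms(2,3)
proof (induction F)
  case empty
  then show ?case
    by (simp add: riemann_zeta_nat[OF s])
next
  case (insert p F)
  define f where "f n = (if \<forall>q\<in>F. \<not> q dvd n then 1 / real n ^ s else 0)" for n
  have p: "prime p" and F: "\<And>q. q \<in> F \<Longrightarrow> prime q"
    using insert.prems by auto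
  have f_summable: "summable f"
    by (rule summable_comparison_test'[OF summable_inverse_power[OF s]]) (auto simp: f_def)
  have f_mult: "f (p * n) = f n / real p ^ s" for n
  proof -
    have "q dvd p * n \<longleftrightarrow> q dvd n" if "q \<in> F" for q
    proof -
      have "\<not> q dvd p"
        using primes_dvd_imp_eq[OF F[OF that] p] insert.hyps that by blast
      then show ?thesis
        by (simp add: prime_dvd_mult_iff F[OF that])
    qed
    then show ?thesis
      by (simp add: f_def power_mult_distrib)
  qed
  define g where "g n = (if p dvd n then f n else 0)" for n
  have g_summable: "summable g"
    by (rule summable_comparison_test'[OF f_summable]) (auto simp: f_def g_def)
  have "suminf g = (\<Sum>n. g (p * n))"
  proof (rule suminf_mono_reindex[symmetric])
    show "strict_mono (\<lambda>n. p * n)"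
      using prime_gt_0_nat[OF p] by (simp add: strict_mono_def)
    show "g n = 0" if "n \<notin> range (\<lambda>n. p * n)" for n
      using that by (auto simp: g_def)
  qed
  also have "\<dots> = suminf f / real p ^ s"
    by (simp add: g_def f_mult suminf_divide[OF f_summable])
  finally have "(1 - 1 / real p ^ s) * suminf f = suminf f - suminf g"
    by (simp add: algebra_simps)
  also have "\<dots> = (\<Sum>n. f n - g n)"
    by (rule suminf_diff[OF f_summable g_summable])
  also have "(\<lambda>n. f n - g n) = (\<lambda>n. if \<forall>q\<in>insert p F. \<not> q dvd n then 1 / real n ^ s else 0)"
    by (auto simp: f_def g_def)
  finally show ?case
    using insert.IH[OF F] insert.hyps by (simp add: f_def mult.assoc)
qed

definition primes_upto :: "nat \<Rightarrow> nat set" where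
  "primes_upto P = {p. prime p \<and> p \<le> P}"

lemma finite_primes_upto [simp]: "finite (primes_upto P)"
  unfolding primes_upto_def by (rule finite_subset[of _ "{..P}"]) auto

text \<open>Among the terms with \<open>n \<le> P\<close>, sieving by the primes up to
  \<open>P\<close> leaves only \<open>n = 1\<close>. Hence the partial product times \<zeta>(s) lies
  between 1 and 1 plus the tail.\<close>

lemma euler_product:
  assumes s: "s \<ge> 2"
  shows "(\<lambda>P. \<Prod>p\<in>primes_upto P. 1 - 1 / real p ^ s) \<longlonglongrightarrow> 1 / riemann_zeta (real s)"
proof -
  define f where "f P n = (if \<forall>p\<in>primes_upto P. \<not> p dvd n then 1 / real n ^ s else 0)" for P n
  have f_summable: "summable (f P)" for P
    by (rule summable_comparison_test'[OF summable_inverse_power[OF s]]) (auto simp: f_def)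
  have prod_eq: "(\<Prod>p\<in>primes_upto P. 1 - 1 / real p ^ s) = suminf (f P) / riemann_zeta (real s)" for P
  proof -
    have "(\<Prod>p\<in>primes_upto P. 1 - 1 / real p ^ s) * riemann_zeta (real s) = suminf (f P)"
      unfolding f_def by (rule euler_product_partial[OF s]) (auto simp: primes_upto_def)
    then show ?thesis
      using riemann_zeta_pos[OF s] by (metis less_irrefl nonzero_mult_div_cancel_right)
  qed
  have initial: "(\<Sum>n<Suc P. f P n) = 1" if "P \<ge> 1" for P
  proof -
    have "f P n = (if n = 1 then 1 else 0)" if "n < Suc P" for n
    proof (cases "n = 0 \<or> n = 1")
      case True
      then show ?thesis
        using s by (auto simp: f_def primes_upto_def)
    next
      case False
      then obtain p where "prime p" "p dvd n"
        using prime_factor_nat by blast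
      moreover have "p \<le> P"
        using dvd_imp_le[OF \<open>p dvd n\<close>] False that by simp
      ultimately show ?thesis
        using False by (auto simp: f_def primes_upto_def)
    qed
    then have "(\<Sum>n<Suc P. f P n) = (\<Sum>n<Suc P. if n = 1 then 1 else 0)"
      by (intro sum.cong) auto
    then show ?thesis
      using that by simp
  qed
  have bounds: "1 \<le> suminf (f P)" "suminf (f P) \<le> 1 + zeta_tail s P" if "P \<ge> 1" for P
  proof -
    have split: "suminf (f P) = 1 + (\<Sum>n. f P (n + Suc P))"
      using suminf_split_initial_segment[OF f_summable, of P "Suc P"] initial[OF that] by simp
    have summ: "summable (\<lambda>n. f P (n + Suc P))"
      using f_summable summable_iff_shift by blast
    have "(\<Sum>n. f P (n + Suc P)) \<ge> 0"
      by (rule suminf_nonneg[OF summ]) (simp add: f_def)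
    then show "1 \<le> suminf (f P)"
      using split by simp
    have "(\<Sum>n. f P (n + Suc P)) \<le> zeta_tail s P"
      unfolding zeta_tail_def
    proof (rule suminf_le[OF _ summ])
      show "summable (\<lambda>m. 1 / real (m + Suc P) ^ s)"
        using summable_inverse_power[OF s] by (rule summable_ignore_initial_segment)
    qed (simp add: f_def)
    then show "suminf (f P) \<le> 1 + zeta_tail s P"
      using split by simp
  qed
  have "(\<lambda>P. suminf (f P)) \<longlonglongrightarrow> 1"
  proof (rule real_tendsto_sandwich)
    show "\<forall>\<^sub>F P in sequentially. 1 \<le> suminf (f P)"
      and "\<forall>\<^sub>F P in sequentially. suminf (f P) \<le> 1 + zeta_tail s P"
      using bounds by (auto simp: eventually_sequentially)
    show "(\<lambda>P. 1 + zeta_tail s P) \<longlonglongrightarrow> 1"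
      using tendsto_add[OF tendsto_const[of 1] zeta_tail_tendsto_0[OF s]] by simp
  qed (rule tendsto_const)
  then show ?thesis
    unfolding prod_eq using riemann_zeta_pos[OF s] by (intro tendsto_divide tendsto_const) auto
qed

subsection \<open>Prescribing the power-free points of a translate\<close>

text \<open>The set of primes is a parameter because three choices occur: all primes for
  \<open>V\<close>, finite sets for its periodic approximations, and the large primes coprime to
  \<open>Q\<close> in the sieve.\<close>

definition pow_free :: "nat set \<Rightarrow> nat \<Rightarrow> int ^ 'n \<Rightarrow> bool" where
  "pow_free F k z \<longleftrightarrow> (\<forall>p\<in>F. \<not> (\<forall>i. int p ^ k dvd z $ i))"

section \<open>Counting in boxes and solving congruences\<close>

lemma card_vec_box:
  fixes S :: "'n::finite \<Rightarrow> 'a set"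
  shows "card {u :: 'a ^ 'n. \<forall>i. u $ i \<in> S i} = (\<Prod>i\<in>UNIV. card (S i))"
    and "(\<And>i. finite (S i)) \<Longrightarrow> finite {u :: 'a ^ 'n. \<forall>i. u $ i \<in> S i}"
proof -
  have bij: "bij_betw vec_nth {u :: 'a ^ 'n. \<forall>i. u $ i \<in> S i} (Pi\<^sub>E UNIV S)"
    by (rule bij_betw_byWitness[where f' = vec_lambda]) auto
  show "card {u :: 'a ^ 'n. \<forall>i. u $ i \<in> S i} = (\<Prod>i\<in>UNIV. card (S i))"
    using bij_betw_same_card[OF bij] by (simp add: card_PiE)
  show "finite {u :: 'a ^ 'n. \<forall>i. u $ i \<in> S i}" if "\<And>i. finite (S i)"
    using bij_betw_finite[OF bij] that by (simp add: finite_PiE)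
qed

lemma finite_vec_coords_bounded:
  fixes A :: "(int ^ 'n) set"
  assumes "finite A"
  obtains M :: nat where "\<And>s i. s \<in> A \<Longrightarrow> \<bar>s $ i\<bar> \<le> int M"
proof -
  have "finite ((\<lambda>(s, i). nat \<bar>s $ i\<bar>) ` (A \<times> UNIV))"
    using assms by auto
  then obtain M where M: "\<And>x. x \<in> (\<lambda>(s, i). nat \<bar>s $ i\<bar>) ` (A \<times> UNIV) \<Longrightarrow> x \<le> M"
    by (meson Max_ge)
  have "\<bar>s $ i\<bar> \<le> int M" if "s \<in> A" for s i
    using M[of "nat \<bar>s $ i\<bar>"] that by force
  then show thesis
    using that by blast
qed

text \<open>As \<open>Q\<close> is invertible modulo \<open>m\<close>, the solutions lie in a single
  residue class, so \<open>u div m\<close> tells them apart.\<close>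

lemma card_residue_class:
  fixes m c Q :: int and X :: nat
  assumes "m > 0" "coprime m Q"
  shows "real (card {u\<in>{0..<int X}. m dvd c + Q * u}) \<le> real X / real_of_int m + 1"
proof -
  define S where "S = {u\<in>{0..<int X}. m dvd c + Q * u}"
  have "inj_on (\<lambda>u. u div m) S"
  proof (rule inj_onI)
    fix u v assume uv: "u \<in> S" "v \<in> S" "u div m = v div m"
    have "m dvd (c + Q * u) - (c + Q * v)"
      using uv by (intro dvd_diff) (auto simp: S_def)
    then have "m dvd Q * (u - v)"
      by (simp add: algebra_simps)
    then have "m dvd u - v"
      using assms(2) by (simp add: coprime_dvd_mult_right_iff)
    then have "u mod m = v mod m"
      by (simp add: mod_eq_dvd_iff)
    with uv(3) show "u = v"
      by (metis mult_div_mod_eq)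
  qed
  moreover have "(\<lambda>u. u div m) ` S \<subseteq> {0..int X div m}"
    using assms(1) by (auto simp: S_def pos_imp_zdiv_nonneg_iff intro!: zdiv_mono1)
  ultimately have "card S \<le> card {0..int X div m}"
    using card_inj_on_le by blast
  also have "\<dots> = nat (int X div m + 1)"
    by simp
  finally have "int (card S) \<le> int X div m + 1"
    using assms(1) pos_imp_zdiv_nonneg_iff[of m "int X"] by simp
  then have "real (card S) \<le> real_of_int (int X div m) + 1"
    by linarith
  moreover have "real_of_int (int X div m) \<le> real X / real_of_int m"
    using real_of_int_div4[of "int X" m] by simp
  ultimately show ?thesis
    by (simp add: S_def)
qed

lemma chinese_remainder_int:
  fixes m :: "'a \<Rightarrow> nat" and r :: "'a \<Rightarrow> int"
  assumes "finite A" "\<And>i j. i \<in> A \<Longrightarrow> j \<in> A \<Longrightarrow> i \<noteq> j \<Longrightarrow> coprime (m i) (m j)"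
    and "\<And>i. i \<in> A \<Longrightarrow> m i > 0"
  shows "\<exists>x. \<forall>i\<in>A. int (m i) dvd x - r i"
proof -
  obtain x where x: "\<forall>i\<in>A. [x = nat (r i mod int (m i))] (mod m i)"
    using chinese_remainder_nat[OF assms(1), of m "\<lambda>i. nat (r i mod int (m i))"] assms(2) by blast
  have "int (m i) dvd int x - r i" if "i \<in> A" for i
  proof -
    have "[int x = int (nat (r i mod int (m i)))] (mod int (m i))"
      using x that by (simp only: cong_int_iff)
    then have "[int x = r i] (mod int (m i))"
      using assms(3)[OF that] by simp
    then show ?thesis
      by (simp add: cong_iff_dvd_diff)
  qed
  then show ?thesis
    by blast
qed

text \<open>A crude constant suffices to separate the main term from the rounding error in the
  sieve.\<close>

lemma add_one_power_le:
  fixes x :: real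
  assumes "x \<ge> 0"
  shows "(x + 1) ^ n \<le> 2 ^ n * (x ^ n + 1)"
proof -
  have "(x + 1) ^ n \<le> (2 * max x 1) ^ n"
    using assms by (intro power_mono) auto
  also have "\<dots> = 2 ^ n * max x 1 ^ n"
    by (simp add: power_mult_distrib)
  also have "max x 1 ^ n \<le> x ^ n + 1"
    using assms by (auto simp: max_def)
  finally show ?thesis
    by simp
qed

lemma divide_power_power: "(x / y ^ k) ^ n = x ^ n * (1 / y ^ (n * k))" for x y :: real
  by (simp only: power_divide power_mult[symmetric] mult.commute[of n k] times_divide_eq_right mult_1_right)

text \<open>
  The bad \<open>u\<close> in the box \<open>[0, X)\<^sup>n\<close> are counted prime by prime. Only primes with
  \<open>p\<^sup>2 \<le> p\<^bsup>nk\<^esup> \<le> Y\<^sup>n\<close> matter, where \<open>Y = O(X)\<close> bounds the coordinates, so the rounding errors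
  contribute \<open>O(X\<^bsup>n/2\<^esup>)\<close>, and the main terms at most half of \<open>X\<^sup>n\<close>.
\<close>

lemma sieve_translate:
  fixes A :: "(int ^ 'n) set" and k P Q :: nat
  assumes fin: "finite A" and Q: "Q > 0" and k: "k \<ge> 1" and nk: "CARD('n) * k \<ge> 2"
    and small: "2 * (2 ^ CARD('n) * real (card A) * zeta_tail (CARD('n) * k) P) \<le> 1"
  shows "\<exists>u. \<forall>s\<in>A. pow_free {p. prime p \<and> P < p \<and> coprime p Q} k (s + int Q *s u)"
proof -
  define n where "n = CARD('n)"
  have n: "n \<ge> 1"
    using zero_less_card_finite[where 'a = 'n] unfolding n_def by linarith
  define N where "N = real (card A)"
  define \<epsilon> where "\<epsilon> = zeta_tail (n * k) P"
  obtain M :: nat where M: "\<And>s i. s \<in> A \<Longrightarrow> \<bar>s $ i\<bar> \<le> int M"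
    using finite_vec_coords_bounded[OF fin] by blast
  \<comment> \<open>With \<open>w = sqrt (X ^ n)\<close>, the vanishing vectors and the rounding
    errors together cost at most \<open>H / 2 * w\<close>; the choice of \<open>X\<close> gives
    \<open>H < w\<close>, so this is below half of \<open>w * w\<close>.\<close>
  define H where "H = 2 * N * (1 + 2 ^ n * sqrt (real (M + Q) ^ n))"
  obtain X :: nat where X: "real X > H\<^sup>2" "X \<ge> 1"
  proof -
    obtain X :: nat where "real X > max (H\<^sup>2) 1"
      using reals_Archimedean2 by blast
    then show thesis
      using that[of X] by simp
  qed
  define Y where "Y = M + Q * X"
  define R where "R = nat \<lfloor>sqrt (real Y ^ n)\<rfloor>"
  define U where "U = {u :: int ^ 'n. \<forall>i. u $ i \<in> {0..<int X}}"
  have U: "finite U" "card U = X ^ n"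
    using card_vec_box[of "\<lambda>_ :: 'n. {0..<int X}"] by (simp_all only: U_def n_def) simp_all
  define bad where "bad s p = {u\<in>U. \<forall>i. int p ^ k dvd (s + int Q *s u) $ i}" for s p
  \<comment> \<open>The zero vector is divisible by every prime power, so the bound on
    \<open>p\<close> cannot rule it out; each \<open>s\<close> meets it for at most one
    \<open>u\<close>.\<close>
  define zero where "zero s = {u\<in>U. s + int Q *s u = 0}" for s
  define J where "J = {p. prime p \<and> P < p \<and> coprime p Q \<and> p \<le> R}"
  have J: "finite J" "J \<subseteq> {P<..}" "card J \<le> R"
  proof -
    have "J \<subseteq> {1..R}"
      by (auto simp: J_def Suc_leI prime_gt_0_nat)
    from finite_subset[OF this] card_mono[OF _ this] show "finite J" "card J \<le> R"
      by auto
  qed (auto simp: J_def)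
  have zero_card: "card (zero s) \<le> 1" for s
  proof -
    have "u = v" if "u \<in> zero s" "v \<in> zero s" for u v
    proof -
      have "int Q *s u = int Q *s v"
        using that by (auto simp: zero_def add_eq_0_iff)
      then show ?thesis
        using Q by (simp add: vec_eq_iff)
    qed
    moreover have "finite (zero s)"
      using U(1) by (simp add: zero_def)
    ultimately show ?thesis
      unfolding One_nat_def by (subst card_le_Suc0_iff_eq) blast+
  qed
  have bad_card: "real (card (bad s p)) \<le> 2 ^ n * (real X ^ n * (1 / real p ^ (n * k)) + 1)" if p: "p \<in> J" for s p
  proof -
    \<comment> \<open>Divisibility is tested coordinate by coordinate, so the bad set is a product
      of one-dimensional solution sets.\<close>
    have "bad s p = {u. \<forall>i. u $ i \<in> {v\<in>{0..<int X}. int p ^ k dvd s $ i + int Q * v}}"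
      by (auto simp: bad_def U_def)
    then have "real (card (bad s p)) = (\<Prod>i\<in>UNIV. real (card {v\<in>{0..<int X}. int p ^ k dvd s $ i + int Q * v}))"
      by (simp only: card_vec_box of_nat_prod)
    also have "\<dots> \<le> (\<Prod>i\<in>(UNIV :: 'n set). real X / real_of_int (int p ^ k) + 1)"
      using p by (intro prod_mono conjI card_residue_class) (auto simp: J_def prime_gt_0_nat)
    also have "\<dots> = (real X / real p ^ k + 1) ^ n"
      by (simp add: n_def)
    also have "\<dots> \<le> 2 ^ n * ((real X / real p ^ k) ^ n + 1)"
      by (rule add_one_power_le) simp
    also have "(real X / real p ^ k) ^ n = real X ^ n * (1 / real p ^ (n * k))"
      by (rule divide_power_power)
    finally show ?thesis .
  qed
  have "real (card (\<Union>s\<in>A. zero s \<union> (\<Union>p\<in>J. bad s p))) \<le> (\<Sum>s\<in>A. 1 + 2 ^ n * (real X ^ n * \<epsilon> + real R))"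
  proof -
    have "card (\<Union>s\<in>A. zero s \<union> (\<Union>p\<in>J. bad s p)) \<le> (\<Sum>s\<in>A. card (zero s \<union> (\<Union>p\<in>J. bad s p)))"
      by (rule card_UN_le[OF fin])
    also have "\<dots> \<le> (\<Sum>s\<in>A. card (zero s) + (\<Sum>p\<in>J. card (bad s p)))"
      by (intro sum_mono order_trans[OF card_Un_le] add_left_mono card_UN_le J)
    finally have "real (card (\<Union>s\<in>A. zero s \<union> (\<Union>p\<in>J. bad s p)))
        \<le> real (\<Sum>s\<in>A. card (zero s) + (\<Sum>p\<in>J. card (bad s p)))"
      by (rule of_nat_mono)
    also have "\<dots> = (\<Sum>s\<in>A. real (card (zero s)) + (\<Sum>p\<in>J. real (card (bad s p))))"
      by simp
    also have "\<dots> \<le> (\<Sum>s\<in>A. 1 + 2 ^ n * (real X ^ n * \<epsilon> + real R))"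
    proof (intro sum_mono add_mono)
      fix s
      show "real (card (zero s)) \<le> 1"
        using zero_card[of s] by simp
      have "(\<Sum>p\<in>J. real (card (bad s p))) \<le> (\<Sum>p\<in>J. 2 ^ n * (real X ^ n * (1 / real p ^ (n * k)) + 1))"
        by (intro sum_mono bad_card)
      also have "\<dots> = 2 ^ n * (real X ^ n * (\<Sum>p\<in>J. 1 / real p ^ (n * k)) + real (card J))"
        by (simp only: sum.distrib sum_distrib_left[symmetric]) simp
      also have "\<dots> \<le> 2 ^ n * (real X ^ n * \<epsilon> + real R)"
        using J nk unfolding \<epsilon>_def n_def
        by (intro mult_left_mono add_mono sum_le_zeta_tail) auto
      finally show "(\<Sum>p\<in>J. real (card (bad s p))) \<le> 2 ^ n * (real X ^ n * \<epsilon> + real R)" .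
    qed
    finally show ?thesis .
  qed
  also have "\<dots> = N * (1 + 2 ^ n * (real X ^ n * \<epsilon> + real R))"
    by (simp add: N_def)
  also have "\<dots> < real X ^ n"
  proof -
    define w where "w = sqrt (real X ^ n)"
    have w2: "w * w = real X ^ n"
      by (simp add: w_def)
    have "real X \<le> real X ^ n"
      using self_le_power[of "real X" n] X(2) n by simp
    then have "H\<^sup>2 < w\<^sup>2"
      using X(1) w2 by (simp only: power2_eq_square)
    then have Hw: "H < w"
      by (rule power2_less_imp_less) (simp add: w_def)
    have w1: "w \<ge> 1"
      using X(2) by (simp add: w_def)
    have "real R \<le> sqrt (real Y ^ n)"
      by (simp add: R_def)
    also have "\<dots> \<le> sqrt ((real (M + Q) * real X) ^ n)"
    proof -
      have "Y \<le> (M + Q) * X"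
        using X(2) by (simp add: Y_def algebra_simps)
      then have "real Y \<le> real (M + Q) * real X"
        by (metis of_nat_le_iff of_nat_mult)
      then show ?thesis
        by (intro real_sqrt_le_mono power_mono) auto
    qed
    also have "\<dots> = sqrt (real (M + Q) ^ n) * w"
      by (simp add: w_def power_mult_distrib real_sqrt_mult)
    finally have R: "real R \<le> sqrt (real (M + Q) ^ n) * w" .
    \<comment> \<open>The assumption \<open>small\<close> caps the main term at half of
      \<open>w * w\<close>.\<close>
    have "N * (1 + 2 ^ n * (real X ^ n * \<epsilon> + real R)) = 2 ^ n * N * \<epsilon> * (w * w) + N * (1 + 2 ^ n * real R)"
      by (simp add: w2 algebra_simps)
    also have "\<dots> \<le> 1 / 2 * (w * w) + N * (w + 2 ^ n * (sqrt (real (M + Q) ^ n) * w))"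
      using small R w1 by (intro add_mono mult_right_mono mult_left_mono) (auto simp: N_def \<epsilon>_def n_def)
    also have "N * (w + 2 ^ n * (sqrt (real (M + Q) ^ n) * w)) = H / 2 * w"
      by (simp add: H_def algebra_simps)
    also have "1 / 2 * (w * w) + H / 2 * w < w * w"
      using Hw w1 by (simp add: field_simps)
    finally show ?thesis
      by (simp add: w2)
  qed
  also have "real X ^ n = real (card U)"
    by (simp add: U)
  finally have "card (\<Union>s\<in>A. zero s \<union> (\<Union>p\<in>J. bad s p)) < card U"
    by simp
  moreover have "finite (\<Union>s\<in>A. zero s \<union> (\<Union>p\<in>J. bad s p))"
    using fin U(1) J(1) by (simp add: zero_def bad_def)
  ultimately have "\<not> U \<subseteq> (\<Union>s\<in>A. zero s \<union> (\<Union>p\<in>J. bad s p))"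
    by (meson card_mono linorder_not_less)
  then obtain u where u: "u \<in> U" "\<And>s. s \<in> A \<Longrightarrow> u \<notin> zero s" "\<And>s p. s \<in> A \<Longrightarrow> p \<in> J \<Longrightarrow> u \<notin> bad s p"
    by blast
  have "\<not> (\<forall>i. int p ^ k dvd (s + int Q *s u) $ i)"
    if s: "s \<in> A" and p: "prime p" "P < p" "coprime p Q" for s p
  proof
    assume dvd: "\<forall>i. int p ^ k dvd (s + int Q *s u) $ i"
    obtain i where i: "(s + int Q *s u) $ i \<noteq> 0"
      using u(1,2) s by (auto simp: zero_def vec_eq_iff)
    have ui: "0 \<le> u $ i" "u $ i \<le> int X"
      using u(1) by (auto simp: U_def less_imp_le)
    have "int p ^ k \<le> \<bar>(s + int Q *s u) $ i\<bar>"
      using dvd_imp_le_int[OF i] dvd by (metis abs_of_nonneg of_nat_0_le_iff zero_le_power)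
    also have "\<dots> \<le> \<bar>s $ i\<bar> + \<bar>int Q * u $ i\<bar>"
      by (simp add: abs_triangle_ineq)
    also have "\<dots> \<le> int M + int Q * int X"
      using M[OF s, of i] ui by (intro add_mono) (auto simp: abs_mult intro: mult_left_mono)
    finally have "int (p ^ k) \<le> int Y"
      by (simp add: Y_def)
    then have pk: "p ^ k \<le> Y"
      by (simp only: of_nat_le_iff)
    have "p ^ 2 \<le> p ^ (k * n)"
      using nk prime_gt_0_nat[OF p(1)] by (intro power_increasing) (auto simp: n_def mult.commute)
    also have "\<dots> \<le> Y ^ n"
      using power_mono[OF pk, of n] by (simp add: power_mult)
    finally have "(real p)\<^sup>2 \<le> real Y ^ n"
      by (metis of_nat_le_iff of_nat_power)
    then have "real p \<le> sqrt (real Y ^ n)"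
      by (rule real_le_rsqrt)
    then have "p \<le> R"
      by (simp add: R_def le_nat_floor)
    then have "p \<in> J"
      using p by (simp add: J_def)
    with u(1,3) s dvd show False
      by (auto simp: bad_def)
  qed
  then show ?thesis
    unfolding pow_free_def by blast
qed

text \<open>
  The points of \<open>W\<close> to be removed get pairwise distinct large primes, while \<open>t\<close> is divisible by
  the \<open>k\<close>-th powers of all small primes, so that it changes nothing there; the sieve takes care
  of the remaining primes.
\<close>

proposition pow_free_translate_pattern:
  fixes W A :: "(int ^ 'n) set"
  assumes W: "finite W" and k: "k \<ge> 1" and nk: "CARD('n) * k \<ge> 2"
    and A: "A \<subseteq> {s\<in>W. pow_free {p. prime p} k s}"
  shows "\<exists>t. \<forall>s\<in>W. pow_free {p. prime p} k (t + s) \<longleftrightarrow> s \<in> A"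
proof -
  obtain M :: nat where M: "\<And>s i. s \<in> W \<Longrightarrow> \<bar>s $ i\<bar> \<le> int M"
    using finite_vec_coords_bounded[OF W] by blast
  have finA: "finite A"
    using finite_subset[OF A] W by simp
  define c where "c = 2 ^ CARD('n) * real (card A)"
  \<comment> \<open>Differences of points of \<open>W\<close> have coordinates at most
    \<open>2 * M\<close>, so \<open>p ^ k\<close> with \<open>p > P\<close> divides no nonzero one.
    The surplus 2 puts the prime 2 among the small primes, and the tail condition feeds the
    sieve.\<close>
  obtain P where P: "P \<ge> 2 * M + 2" "2 * (c * zeta_tail (CARD('n) * k) P) \<le> 1"
  proof -
    have "(\<lambda>P. 2 * (c * zeta_tail (CARD('n) * k) P)) \<longlonglongrightarrow> 2 * (c * 0)"
      by (intro tendsto_mult tendsto_const zeta_tail_tendsto_0 nk)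
    then have "\<forall>\<^sub>F P in sequentially. 2 * (c * zeta_tail (CARD('n) * k) P) < 1"
      by (rule order_tendstoD) simp
    with eventually_ge_at_top[of "2 * M + 2"]
    have "\<forall>\<^sub>F P in sequentially. P \<ge> 2 * M + 2 \<and> 2 * (c * zeta_tail (CARD('n) * k) P) < 1"
      by eventually_elim simp
    then show thesis
      using that by (auto simp: eventually_sequentially)
  qed
  \<comment> \<open>Only these power-free points have to be destroyed; the others outside
    \<open>A\<close> are already divisible by a small prime power and remain so.\<close>
  define D where "D = {s\<in>W. pow_free {p. prime p} k s} - A"
  have finD: "finite D"
    using W by (simp add: D_def)
  have "infinite {p. prime p \<and> P < p}"
  proof
    assume "finite {p. prime p \<and> P < p}"
    then have "finite ({p. prime p \<and> P < p} \<union> {..P})"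
      by simp
    then have "finite {p :: nat. prime p}"
      by (rule finite_subset[rotated]) auto
    then show False
      using primes_infinite by blast
  qed
  then obtain C where C: "finite C" "card C = card D" "C \<subseteq> {p. prime p \<and> P < p}"
    using infinite_arbitrarily_large[of _ "card D"] by blast
  then obtain d where d: "bij_betw d C D"
    using finite_same_card_bij[OF C(1) finD] by auto
  define I where "I = primes_upto P \<union> C"
  have I: "finite I" "\<And>p. p \<in> I \<Longrightarrow> prime p"
    using C by (auto simp: I_def primes_upto_def)
  \<comment> \<open>The residue \<open>- d p\<close> makes \<open>t + d p\<close> divisible by
    \<open>p ^ k\<close>; the residue 0 at a small prime leaves divisibility by its power
    unchanged.\<close>
  define r where "r p = (if p \<le> P then 0 else - d p)" for p
  have "\<exists>x. \<forall>p\<in>I. int (p ^ k) dvd x - r p $ i" for i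
    using I by (intro chinese_remainder_int) (auto simp: primes_coprime prime_gt_0_nat)
  then obtain x where x: "\<And>i p. p \<in> I \<Longrightarrow> int p ^ k dvd x i - r p $ i"
    by (metis of_nat_power)
  define t0 where "t0 = vec_lambda x"
  define Q where "Q = (\<Prod>p\<in>I. p ^ k)"
  have "Q > 0"
    using I by (auto simp: Q_def prime_gt_0_nat intro!: prod_pos)
  have card_le: "real (card ((+) t0 ` A)) \<le> real (card A)"
    using card_image_le[OF finA] by simp
  have "2 * (2 ^ CARD('n) * real (card ((+) t0 ` A)) * zeta_tail (CARD('n) * k) P)
      \<le> 2 * (c * zeta_tail (CARD('n) * k) P)"
    unfolding c_def using zeta_tail_nonneg[OF nk] card_le
    by (intro mult_left_mono mult_right_mono) auto
  with P(2) have "\<exists>u. \<forall>s\<in>(+) t0 ` A. pow_free {p. prime p \<and> P < p \<and> coprime p Q} k (s + int Q *s u)"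
    by (intro sieve_translate \<open>Q > 0\<close> k nk finite_imageI finA) simp
  then obtain u where u: "\<And>s. s \<in> A \<Longrightarrow> pow_free {p. prime p \<and> P < p \<and> coprime p Q} k (t0 + s + int Q *s u)"
    by blast
  define t where "t = t0 + int Q *s u"
  have dvd_iff: "int p ^ k dvd (t + s) $ i \<longleftrightarrow> int p ^ k dvd (r p + s) $ i" if "p \<in> I" for p s i
  proof -
    have "p ^ k dvd Q"
      unfolding Q_def using I(1) that by (rule dvd_prodI)
    then have "int p ^ k dvd int Q"
      by (metis of_nat_dvd_iff of_nat_power)
    then have "int p ^ k dvd (x i - r p $ i) + int Q * u $ i"
      using x[OF that] by simp
    moreover have "(t + s) $ i = ((x i - r p $ i) + int Q * u $ i) + (r p + s) $ i"
      by (simp add: t_def t0_def)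
    ultimately show ?thesis
      by (simp only: dvd_add_right_iff)
  qed
  have small: "int p ^ k dvd (t + s) $ i \<longleftrightarrow> int p ^ k dvd s $ i" if "prime p" "p \<le> P" for p s i
    using dvd_iff[of p s i] that by (simp add: I_def r_def primes_upto_def)
  have large: "int p ^ k dvd (t + s) $ i \<longleftrightarrow> int p ^ k dvd s $ i - d p $ i" if "p \<in> C" for p s i
    using dvd_iff[of p s i] that C(3) by (auto simp: I_def r_def)
  have not_dvd: "\<not> int p ^ k dvd a" if "a \<noteq> 0" "\<bar>a\<bar> \<le> int P" "P < p" for p a
  proof
    assume "int p ^ k dvd a"
    then have "int p ^ k \<le> \<bar>a\<bar>"
      using dvd_imp_le_int[OF that(1)] by (metis abs_of_nonneg of_nat_0_le_iff zero_le_power)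
    moreover have "p \<le> p ^ k"
      using k that(3) by (intro self_le_power) auto
    then have "int p \<le> int p ^ k"
      by (metis of_nat_le_iff of_nat_power)
    ultimately show False
      using that by linarith
  qed
  have "pow_free {p. prime p} k (t + s)" if s: "s \<in> A" for s
    unfolding pow_free_def
  proof (intro ballI)
    fix p :: nat assume "p \<in> {p. prime p}"
    then have p: "prime p"
      by simp
    have s_free: "\<not> (\<forall>i. int p ^ k dvd s $ i)" and sW: "s \<in> W"
      using s A p by (auto simp: pow_free_def)
    \<comment> \<open>Small primes see \<open>s\<close> itself; a prime in \<open>C\<close> would
      have to divide the nonzero difference of \<open>s\<close> and its target \<open>d p\<close>;
      all other primes are coprime to \<open>Q\<close> and handled by the sieve.\<close>
    consider "p \<le> P" | "p \<in> C" | "P < p" "p \<notin> I"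
      by (auto simp: I_def primes_upto_def) linarith
    then show "\<not> (\<forall>i. int p ^ k dvd (t + s) $ i)"
    proof cases
      case 1
      then show ?thesis
        using small[OF p 1] s_free by simp
    next
      case 2
      then have "d p \<in> D"
        using d by (auto simp: bij_betw_def)
      then have dp: "d p \<noteq> s" "d p \<in> W"
        using s by (auto simp: D_def)
      then obtain i where i: "s $ i - d p $ i \<noteq> 0"
        by (metis right_minus_eq vec_eq_iff)
      have "\<bar>s $ i - d p $ i\<bar> \<le> int P"
        using M[OF sW, of i] M[OF dp(2), of i] P(1) by linarith
      then have "\<not> int p ^ k dvd s $ i - d p $ i"
        using i 2 C(3) by (intro not_dvd) auto
      then show ?thesis
        using large[OF 2] by blast
    next
      case 3
      have "coprime p Q"
        unfolding Q_def using 3 I p by (intro prod_coprime_right) (auto intro!: primes_coprime)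
      then show ?thesis
        using u[OF s] 3 p by (auto simp: pow_free_def t_def algebra_simps)
    qed
  qed
  moreover have "\<not> pow_free {p. prime p} k (t + s)" if s: "s \<in> W" "s \<notin> A" for s
  proof (cases "s \<in> D")
    case True
    then obtain p where p: "p \<in> C" "d p = s"
      using d True by (auto simp: bij_betw_def)
    then have "\<forall>i. int p ^ k dvd (t + s) $ i"
      using large[OF p(1)] by simp
    then show ?thesis
      using p(1) C(3) by (auto simp: pow_free_def)
  next
    case False
    then obtain p where p: "prime p" "\<forall>i. int p ^ k dvd s $ i"
      using s by (auto simp: D_def pow_free_def)
    \<comment> \<open>A nonzero \<open>s\<close> has coordinates too small for a prime above
      \<open>P\<close>; for \<open>s = 0\<close> every prime works, and 2 is small.\<close>
    obtain q where q: "prime q" "q \<le> P" "\<forall>i. int q ^ k dvd s $ i"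
    proof (cases "s = 0")
      case True
      then show thesis
        using that[of 2] P(1) by simp
    next
      case False
      then obtain i where "s $ i \<noteq> 0"
        by (auto simp: vec_eq_iff)
      then have "p \<le> P"
        using not_dvd[of "s $ i" p] M[OF s(1), of i] P(1) p(2) by force
      then show thesis
        using that p by blast
    qed
    then have "\<forall>i. int q ^ k dvd (t + s) $ i"
      using small by simp
    then show ?thesis
      using q(1) by (auto simp: pow_free_def)
  qed
  ultimately show ?thesis
    using A by blast
qed

subsection \<open>Density of power-free points\<close>

definition free_count :: "nat set \<Rightarrow> nat \<Rightarrow> real ^ 'n ^ 'n \<Rightarrow> real ^ 'n \<Rightarrow> real \<Rightarrow> nat" where
  "free_count F k B x r = card {z. pow_free F k z \<and> lattice_point B z \<in> ball x r}"

lemma finite_lattice_ball: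
  assumes "invertible B"
  shows "finite {z. lattice_point B z \<in> ball x r}"
  by (rule lattice_count_bounds[OF assms])

lemma finite_free_ball:
  assumes "invertible B"
  shows "finite {z. pow_free F k z \<and> lattice_point B z \<in> ball x r}"
  by (rule finite_subset[OF _ finite_lattice_ball[OF assms]]) auto

text \<open>\<open>p ^ k\<close> is a unit modulo \<open>q ^ k\<close> for every other prime
  \<open>q\<close>.\<close>

lemma pow_free_scale:
  assumes "prime p" "p \<notin> F" "\<And>q. q \<in> F \<Longrightarrow> prime q"
  shows "pow_free F k (int (p ^ k) *s w) \<longleftrightarrow> pow_free F k w"
proof -
  have "int q ^ k dvd int (p ^ k) * a \<longleftrightarrow> int q ^ k dvd a" if "q \<in> F" for q a
  proof (rule coprime_dvd_mult_right_iff)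
    have "coprime q p"
      using that assms by (metis primes_coprime)
    then show "coprime (int q ^ k) (int (p ^ k))"
      by simp
  qed
  then show ?thesis
    by (auto simp: pow_free_def)
qed

lemma dvd_vec_iff: "(\<forall>i. c dvd z $ i) \<longleftrightarrow> (\<exists>w. z = c *s w)" for c :: int
proof
  assume "\<forall>i. c dvd z $ i"
  then have "z = c *s (\<chi> i. z $ i div c)"
    by (simp add: vec_eq_iff)
  then show "\<exists>w. z = c *s w" ..
qed auto

lemma lattice_point_scale_ball:
  assumes "c > 0"
  shows "lattice_point B (c *s w) \<in> ball x r \<longleftrightarrow>
    lattice_point B w \<in> ball (x /\<^sub>R real_of_int c) (r / real_of_int c)"
proof -
  have "dist x (lattice_point B (c *s w)) = real_of_int c * dist (x /\<^sub>R real_of_int c) (lattice_point B w)"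
  proof -
    have "x - lattice_point B (c *s w) = real_of_int c *\<^sub>R (x /\<^sub>R real_of_int c - lattice_point B w)"
      using assms by (simp add: lattice_point_scale scaleR_diff_right)
    then show ?thesis
      using assms by (simp add: dist_norm)
  qed
  then show ?thesis
    using assms by (simp add: field_simps)
qed

text \<open>The points lost on adding \<open>p\<close> are the multiples of \<open>p ^ k\<close>.
  Dividing them by \<open>p ^ k\<close> gives the points free for \<open>F\<close> in a ball shrunk
  by the same factor.\<close>

lemma free_count_insert:
  assumes B: "invertible B" and p: "prime p" "p \<notin> F" and F: "\<And>q. q \<in> F \<Longrightarrow> prime q"
  shows "free_count F k B x r =
    free_count (insert p F) k B x r + free_count F k B (x /\<^sub>R real p ^ k) (r / real p ^ k)"
proof -
  define c where "c = int (p ^ k)"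
  have c: "c > 0"
    using prime_gt_0_nat[OF p(1)] by (simp add: c_def)
  define S where "S = {z. pow_free F k z \<and> lattice_point B z \<in> ball x r}"
  define T where "T = {w. pow_free F k w \<and> lattice_point B w \<in> ball (x /\<^sub>R real_of_int c) (r / real_of_int c)}"
  define S' where "S' = {z. pow_free (insert p F) k z \<and> lattice_point B z \<in> ball x r}"
  have "c *s w \<in> S \<longleftrightarrow> w \<in> T" for w
    unfolding S_def T_def mem_Collect_eq lattice_point_scale_ball[OF c]
    using pow_free_scale[OF p F, of k w] by (simp add: c_def)
  then have "{z\<in>S. \<forall>i. c dvd z $ i} = (\<lambda>w. c *s w) ` T"
    unfolding dvd_vec_iff by auto
  moreover have "S = S' \<union> {z\<in>S. \<forall>i. c dvd z $ i}"
    by (auto simp: S_def S'_def pow_free_def c_def)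
  ultimately have S: "S = S' \<union> (\<lambda>w. c *s w) ` T"
    by simp
  have fin: "finite S"
    unfolding S_def by (rule finite_free_ball[OF B])
  have "S' \<inter> (\<lambda>w. c *s w) ` T = {}"
    by (auto simp: S'_def pow_free_def c_def)
  then have "card S = card S' + card ((\<lambda>w. c *s w) ` T)"
    using fin unfolding S by (intro card_Un_disjoint) auto
  moreover have "inj_on (\<lambda>w. c *s w) T"
    using c by (auto simp: inj_on_def vec_eq_iff)
  ultimately have "card S = card S' + card T"
    by (simp add: card_image)
  then show ?thesis
    by (simp add: free_count_def S_def S'_def T_def c_def)
qed

text \<open>For \<open>s = n * k\<close>, with \<open>n\<close> the dimension, this is the density
  of the points that are free for \<open>F\<close>.\<close>

definition free_density :: "nat \<Rightarrow> nat set \<Rightarrow> real" where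
  "free_density s F = (\<Prod>p\<in>F. 1 - 1 / real p ^ s)"

text \<open>Uniformity in the centre comes from \<open>d\<close> being independent of
  \<open>x\<close>: both \<open>v * (r + d) ^ n\<close> and \<open>v * (r - d) ^ n\<close> are
  asymptotic to \<open>v * r ^ n\<close>.\<close>

lemma lattice_count_uniform:
  fixes B :: "real ^ 'n ^ 'n"
  assumes B: "invertible B" "\<bar>det B\<bar> = 1" and "\<epsilon> > 0"
  shows "\<forall>\<^sub>F r in at_top. \<forall>x.
    \<bar>real (card {z. lattice_point B z \<in> ball x r}) - measure lborel (ball (0 :: real ^ 'n) 1) * r ^ CARD('n)\<bar>
      \<le> \<epsilon> * r ^ CARD('n)"
proof -
  define n where "n = CARD('n)"
  define v where "v = measure lborel (ball (0 :: real ^ 'n) 1)"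
  obtain d where d: "d > 0"
    and "\<And>x r. finite {z. lattice_point B z \<in> ball x r}"
    and upper: "\<And>x r. r \<ge> 0 \<Longrightarrow> real (card {z. lattice_point B z \<in> ball x r}) \<le> v * (r + d) ^ n"
    and lower: "\<And>x r. r \<ge> d \<Longrightarrow> v * (r - d) ^ n \<le> real (card {z. lattice_point B z \<in> ball x r})"
    by (fact lattice_count_bounds[OF B(1), folded n_def v_def, unfolded B(2) mult_1_right])
  have inv: "((\<lambda>r. d / r) \<longlongrightarrow> 0) at_top"
    by (rule tendsto_divide_0[OF tendsto_const filterlim_at_top_imp_at_infinity[OF filterlim_ident]])
  have "((\<lambda>r. v * (1 + d / r) ^ n) \<longlongrightarrow> v * (1 + 0) ^ n) at_top"
    by (intro tendsto_intros inv)
  then have "\<forall>\<^sub>F r in at_top. v * (1 + d / r) ^ n < v + \<epsilon>"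
    by (rule order_tendstoD) (use assms in simp)
  moreover have "((\<lambda>r. v * (1 - d / r) ^ n) \<longlongrightarrow> v * (1 - 0) ^ n) at_top"
    by (intro tendsto_intros inv)
  then have "\<forall>\<^sub>F r in at_top. v * (1 - d / r) ^ n > v - \<epsilon>"
    by (rule order_tendstoD) (use assms in simp)
  ultimately show ?thesis
    using eventually_ge_at_top[of d] unfolding n_def[symmetric] v_def[symmetric]
  proof eventually_elim
    case (elim r)
    then have r: "r > 0"
      using d by simp
    have "v * (r + d) ^ n = v * (1 + d / r) ^ n * r ^ n"
      using r by (simp add: field_simps flip: power_mult_distrib)
    also have "\<dots> \<le> (v + \<epsilon>) * r ^ n"
      using elim(1) r by (intro mult_right_mono) auto
    finally have 1: "v * (r + d) ^ n \<le> v * r ^ n + \<epsilon> * r ^ n"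
      by (simp add: algebra_simps)
    have "(v - \<epsilon>) * r ^ n \<le> v * (1 - d / r) ^ n * r ^ n"
      using elim(2) r by (intro mult_right_mono) auto
    also have "\<dots> = v * (r - d) ^ n"
      using r by (simp add: field_simps flip: power_mult_distrib)
    finally have 2: "v * r ^ n - \<epsilon> * r ^ n \<le> v * (r - d) ^ n"
      by (simp add: algebra_simps)
    show ?case
    proof
      fix x
      show "\<bar>real (card {z. lattice_point B z \<in> ball x r}) - v * r ^ n\<bar> \<le> \<epsilon> * r ^ n"
        using upper[of r x] lower[of r x] elim(3) r 1 2 by linarith
    qed
  qed
qed

text \<open>The quantifier over \<open>x\<close> stands inside \<open>eventually\<close> because the
  recursion moves the centre to \<open>x / c\<close>, and because patches have arbitrary centres.
  Two counts enter each step, each allowed half of \<epsilon>.\<close>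

proposition free_count_uniform:
  fixes B :: "real ^ 'n ^ 'n"
  assumes B: "invertible B" "\<bar>det B\<bar> = 1" and F: "finite F" "\<And>q. q \<in> F \<Longrightarrow> prime q" and "\<epsilon> > 0"
  shows "\<forall>\<^sub>F r in at_top. \<forall>x.
    \<bar>real (free_count F k B x r) -
      free_density (CARD('n) * k) F * measure lborel (ball (0 :: real ^ 'n) 1) * r ^ CARD('n)\<bar>
      \<le> \<epsilon> * r ^ CARD('n)"
  using F \<open>\<epsilon> > 0\<close>
proof (induction F arbitrary: \<epsilon>)
  case empty
  then show ?case
    using lattice_count_uniform[OF B] by (simp add: free_count_def free_density_def pow_free_def)
next
  case (insert p F)
  define n where "n = CARD('n)"
  define v where "v = measure lborel (ball (0 :: real ^ 'n) 1)"
  define D where "D = free_density (n * k) F"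
  define c where "c = real p ^ k"
  have p: "prime p" and F: "\<And>q. q \<in> F \<Longrightarrow> prime q"
    using insert.prems by auto
  have c: "c \<ge> 1"
    using prime_ge_1_nat[OF p] by (simp add: c_def)
  have IH: "\<forall>\<^sub>F r in at_top. \<forall>x. \<bar>real (free_count F k B x r) - D * v * r ^ n\<bar> \<le> \<epsilon> / 2 * r ^ n"
    using insert.IH[OF F, of "\<epsilon> / 2"] insert.prems by (simp add: n_def v_def D_def)
  \<comment> \<open>This makes the induction hypothesis available at the shrunken radius
    \<open>r / c\<close>.\<close>
  have "filterlim (\<lambda>r. r / c) at_top at_top"
    using c filterlim_tendsto_pos_mult_at_top[OF tendsto_const[of "1 / c"] _ filterlim_ident] by simp
  from eventually_compose_filterlim[OF IH this] IH eventually_gt_at_top[of 0]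
  show ?case
    unfolding n_def[symmetric] v_def[symmetric]
  proof eventually_elim
    case (elim r)
    show ?case
    proof
      fix x
      have Dp: "free_density (n * k) (insert p F) = D - D / c ^ n"
        using insert.hyps
        by (simp add: free_density_def D_def c_def left_diff_distrib power_mult[symmetric] mult.commute[of k n])
      have count: "real (free_count (insert p F) k B x r) =
          real (free_count F k B x r) - real (free_count F k B (x /\<^sub>R c) (r / c))"
        using free_count_insert[OF B(1) p insert.hyps(2) F, where k = k and x = x and r = r]
        by (simp add: c_def)
      have "\<bar>real (free_count F k B (x /\<^sub>R c) (r / c)) - D * v * (r / c) ^ n\<bar> \<le> \<epsilon> / 2 * (r / c) ^ n"
        using elim(1) by blast
      also have "\<dots> \<le> \<epsilon> / 2 * r ^ n"
      proof (intro mult_left_mono power_mono)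
        show "r / c \<le> r"
          using divide_left_mono[of 1 c r] c elim(3) by simp
      qed (use c elim(3) insert.prems in auto)
      finally have "\<bar>real (free_count F k B (x /\<^sub>R c) (r / c)) - D * v * (r / c) ^ n\<bar> \<le> \<epsilon> / 2 * r ^ n" .
      moreover have "\<bar>real (free_count F k B x r) - D * v * r ^ n\<bar> \<le> \<epsilon> / 2 * r ^ n"
        using elim(2) by blast
      moreover have "free_density (n * k) (insert p F) * v * r ^ n = D * v * r ^ n - D * v * (r / c) ^ n"
        unfolding Dp by (simp add: power_divide algebra_simps)
      ultimately show "\<bar>real (free_count (insert p F) k B x r) - free_density (n * k) (insert p F) * v * r ^ n\<bar> \<le> \<epsilon> * r ^ n"
        unfolding count by linarith
    qed
  qed
qed

text \<open>The bound must hold for every positive radius, since it is applied at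
  \<open>r / p ^ k\<close> for arbitrarily large \<open>p\<close>. Leaving out the origin makes this
  possible: a ball shorter than every nonzero lattice vector counts nothing.\<close>

lemma nonzero_lattice_count:
  fixes B :: "real ^ 'n ^ 'n"
  assumes B: "invertible B"
  obtains C where "C \<ge> 0"
    and "\<And>r. r > 0 \<Longrightarrow> real (card {z. z \<noteq> 0 \<and> lattice_point B z \<in> ball 0 r}) \<le> C * r ^ CARD('n)"
proof -
  define n where "n = CARD('n)"
  define v where "v = measure lborel (ball (0 :: real ^ 'n) 1)"
  obtain d where d: "d > 0"
    and "\<And>x r. finite {z. lattice_point B z \<in> ball x r}"
    and upper: "\<And>x r. r \<ge> 0 \<Longrightarrow> real (card {z. lattice_point B z \<in> ball x r}) * \<bar>det B\<bar> \<le> v * (r + d) ^ n"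
    and "\<And>x r. r \<ge> d \<Longrightarrow> v * (r - d) ^ n \<le> real (card {z. lattice_point B z \<in> ball x r}) * \<bar>det B\<bar>"
    by (fact lattice_count_bounds[OF B, folded n_def v_def])
  have det: "\<bar>det B\<bar> > 0"
    using B by (simp add: invertible_det_nz)
  obtain b where b: "b > 0" "\<And>w. b * norm w \<le> norm (B *v w)"
    using linear_inj_bounded_below_pos[of "(*v) B"] inj_matrix_vector_mult[OF B] by (auto simp: mult.commute)
  have away: "b \<le> norm (lattice_point B z)" if "z \<noteq> 0" for z
  proof -
    obtain i where "z $ i \<noteq> 0"
      using \<open>z \<noteq> 0\<close> by (metis vec_eq_iff zero_index)
    then have "1 \<le> \<bar>real_of_int (z $ i)\<bar>"
      by linarith
    also have "\<dots> \<le> norm (\<chi> i. real_of_int (z $ i))"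
      using component_le_norm_cart[of "\<chi> i. real_of_int (z $ i)" i] by simp
    finally have "b * 1 \<le> b * norm (\<chi> i. real_of_int (z $ i))"
      using b(1) by (intro mult_left_mono) auto
    then show ?thesis
      using b(2)[of "\<chi> i. real_of_int (z $ i)"] by (simp add: lattice_point_def)
  qed
  \<comment> \<open>For \<open>r > b\<close> the boundary width satisfies
    \<open>d \<le> d / b * r\<close>, so it is absorbed into the factor
    \<open>1 + d / b\<close>.\<close>
  define C where "C = v * (1 + d / b) ^ n / \<bar>det B\<bar>"
  have C: "C \<ge> 0"
    using b d by (simp add: C_def v_def)
  have "real (card {z. z \<noteq> 0 \<and> lattice_point B z \<in> ball 0 r}) \<le> C * r ^ n" if r: "r > 0" for r
  proof (cases "r > b")
    case False
    then have "{z. z \<noteq> 0 \<and> lattice_point B z \<in> ball 0 r} = {}"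
      using away by fastforce
    then have "card {z. z \<noteq> 0 \<and> lattice_point B z \<in> ball 0 r} = 0"
      by (simp only: card.empty)
    then show ?thesis
      using C r by (simp only:) simp
  next
    case True
    have "card {z. z \<noteq> 0 \<and> lattice_point B z \<in> ball 0 r} \<le> card {z. lattice_point B z \<in> ball 0 r}"
      by (rule card_mono[OF finite_lattice_ball[OF B]]) auto
    then have "real (card {z. z \<noteq> 0 \<and> lattice_point B z \<in> ball 0 r}) * \<bar>det B\<bar> \<le>
        real (card {z. lattice_point B z \<in> ball 0 r}) * \<bar>det B\<bar>"
      by (intro mult_right_mono) simp_all
    also have "\<dots> \<le> v * (r + d) ^ n"
      using r by (intro upper) simp
    also have "\<dots> \<le> v * ((1 + d / b) * r) ^ n"
      using True r d b by (intro mult_left_mono power_mono) (auto simp: v_def field_simps)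
    also have "\<dots> = C * r ^ n * \<bar>det B\<bar>"
      using det by (simp add: C_def power_mult_distrib)
    finally show ?thesis
      using det by (simp only: mult_le_cancel_right_pos)
  qed
  with C show thesis
    using that by (simp add: n_def)
qed

text \<open>A point surviving the small primes but not all primes is a nonzero multiple of
  \<open>p ^ k\<close> for some \<open>p > P\<close>. There are at most
  \<open>C * (r / p ^ k) ^ n\<close> of these for each \<open>p\<close>, and summing over
  \<open>p\<close> gives the tail.\<close>

lemma free_count_primes_lower:
  fixes B :: "real ^ 'n ^ 'n"
  assumes B: "invertible B" and P: "P \<ge> 2" and nk: "CARD('n) * k \<ge> 2" and r: "r > 0"
    and C: "C \<ge> 0" "\<And>r. r > 0 \<Longrightarrow> real (card {z. z \<noteq> 0 \<and> lattice_point B z \<in> ball 0 r}) \<le> C * r ^ CARD('n)"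
  shows "real (free_count (primes_upto P) k B 0 r) \<le>
    real (free_count {p. prime p} k B 0 r) + C * zeta_tail (CARD('n) * k) P * r ^ CARD('n)"
proof -
  define n where "n = CARD('n)"
  define S where "S F = {z. pow_free F k z \<and> lattice_point B z \<in> ball 0 r}" for F
  define E where "E p = {z. z \<noteq> 0 \<and> (\<forall>i. int p ^ k dvd z $ i) \<and> lattice_point B z \<in> ball 0 r}" for p
  have fin: "finite (S F)" for F
    unfolding S_def by (rule finite_free_ball[OF B])
  have "\<exists>p. prime p \<and> P < p \<and> z \<in> E p" if z: "z \<in> S (primes_upto P) - S {p. prime p}" for z
  proof -
    obtain p where p: "prime p" "\<forall>i. int p ^ k dvd z $ i"
      using z by (auto simp: S_def pow_free_def)
    have "P < p"
    proof (rule ccontr)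
      assume "\<not> P < p"
      then have "p \<in> primes_upto P"
        using p(1) by (simp add: primes_upto_def)
      then show False
        using z p(2) by (auto simp: S_def pow_free_def)
    qed
    moreover have "z \<noteq> 0"
    proof
      assume "z = 0"
      moreover have "2 \<in> primes_upto P"
        using P by (simp add: primes_upto_def)
      ultimately show False
        using z by (auto simp: S_def pow_free_def)
    qed
    ultimately show ?thesis
      using z p by (auto simp: E_def S_def)
  qed
  \<comment> \<open>Choosing one prime per lost point reduces the union over all large primes to a
    finite one.\<close>
  then obtain f where f: "\<And>z. z \<in> S (primes_upto P) - S {p. prime p} \<Longrightarrow> prime (f z) \<and> P < f z \<and> z \<in> E (f z)"
    by metis
  define J where "J = f ` (S (primes_upto P) - S {p. prime p})"
  have J: "finite J" "J \<subseteq> {P<..}" "\<And>p. p \<in> J \<Longrightarrow> prime p"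
    using fin f unfolding J_def by blast+
  have finE: "finite (E p)" for p
    by (rule finite_subset[OF _ finite_lattice_ball[OF B, of 0 r]]) (auto simp: E_def)
  have "S (primes_upto P) \<subseteq> S {p. prime p} \<union> (\<Union>p\<in>J. E p)"
    using f by (auto simp: J_def)
  then have "card (S (primes_upto P)) \<le> card (S {p. prime p} \<union> (\<Union>p\<in>J. E p))"
    using fin finE J by (intro card_mono) auto
  also have "\<dots> \<le> card (S {p. prime p}) + (\<Sum>p\<in>J. card (E p))"
    by (intro order_trans[OF card_Un_le] add_left_mono card_UN_le J)
  finally have "real (card (S (primes_upto P))) \<le> real (card (S {p. prime p}) + (\<Sum>p\<in>J. card (E p)))"
    by (rule of_nat_mono)
  also have "\<dots> = real (card (S {p. prime p})) + (\<Sum>p\<in>J. real (card (E p)))"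
    by simp
  also have "(\<Sum>p\<in>J. real (card (E p))) \<le> (\<Sum>p\<in>J. C * r ^ n * (1 / real p ^ (n * k)))"
  proof (rule sum_mono)
    fix p assume "p \<in> J"
    then have p: "p > 0"
      using J(3) prime_gt_0_nat by blast
    define c where "c = int (p ^ k)"
    have c: "c > 0"
      using p by (simp add: c_def)
    have "E p = (\<lambda>w. c *s w) ` {w. w \<noteq> 0 \<and> lattice_point B w \<in> ball 0 (r / real_of_int c)}"
    proof -
      have iff: "c *s w \<noteq> 0 \<and> lattice_point B (c *s w) \<in> ball 0 r \<longleftrightarrow>
          w \<noteq> 0 \<and> lattice_point B w \<in> ball 0 (r / real_of_int c)" for w
        using lattice_point_scale_ball[OF c, of B w 0 r] c by (simp add: vec_eq_iff)
      have "E p = {z. (\<exists>w. z = c *s w) \<and> z \<noteq> 0 \<and> lattice_point B z \<in> ball 0 r}"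
        unfolding E_def dvd_vec_iff[symmetric] c_def of_nat_power by (rule Collect_cong) blast
      also have "\<dots> = (\<lambda>w. c *s w) ` {w. c *s w \<noteq> 0 \<and> lattice_point B (c *s w) \<in> ball 0 r}"
        by (auto simp: image_iff)
      finally show ?thesis
        unfolding iff .
    qed
    moreover have "card ((\<lambda>w. c *s w) ` {w. w \<noteq> 0 \<and> lattice_point B w \<in> ball 0 (r / real_of_int c)}) \<le>
        card {w. w \<noteq> 0 \<and> lattice_point B w \<in> ball 0 (r / real_of_int c)}"
      by (rule card_image_le, rule finite_subset[OF _ finite_lattice_ball[OF B, of 0 "r / real_of_int c"]]) auto
    ultimately have "real (card (E p)) \<le> C * (r / real_of_int c) ^ n"
      using C(2)[of "r / real_of_int c"] c r unfolding n_def by simp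
    also have "\<dots> = C * r ^ n * (1 / real p ^ (n * k))"
      unfolding mult.assoc divide_power_power[symmetric] by (simp add: c_def)
    finally show "real (card (E p)) \<le> C * r ^ n * (1 / real p ^ (n * k))" .
  qed
  also have "\<dots> \<le> C * r ^ n * zeta_tail (n * k) P"
    unfolding sum_distrib_left[symmetric] using C(1) r J nk
    by (intro mult_left_mono sum_le_zeta_tail) (auto simp: n_def)
  finally show ?thesis
    by (simp add: free_count_def S_def n_def mult_ac)
qed

subsection \<open>Counting patches\<close>

text \<open>Passes from arbitrary factors, as in the content, to primes: a prime factor
  \<open>p\<close> of \<open>c\<close> has \<open>p ^ k\<close> dividing
  \<open>c ^ k\<close>.\<close>

lemma ex_power_dvd_iff_ex_prime:
  fixes z :: "int ^ 'n"
  shows "(\<exists>c\<ge>2. \<forall>i. int c ^ k dvd z $ i) \<longleftrightarrow> \<not> pow_free {p. prime p} k z"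
proof
  assume "\<exists>c\<ge>2. \<forall>i. int c ^ k dvd z $ i"
  then obtain c where c: "c \<ge> 2" "\<And>i. int c ^ k dvd z $ i"
    by blast
  obtain p where p: "prime p" "p dvd c"
    using prime_factor_nat[of c] c(1) by auto
  have "int p ^ k dvd int c ^ k"
    using p(2) by (intro dvd_power_same) simp
  then have "\<forall>i. int p ^ k dvd z $ i"
    using c(2) dvd_trans by blast
  then show "\<not> pow_free {p. prime p} k z"
    using p(1) by (auto simp: pow_free_def)
next
  assume "\<not> pow_free {p. prime p} k z"
  then obtain p :: nat where "prime p" "\<forall>i. int p ^ k dvd z $ i"
    by (auto simp: pow_free_def)
  then show "\<exists>c\<ge>2. \<forall>i. int c ^ k dvd z $ i"
    using prime_ge_2_nat by blast
qed

text \<open>At the origin both sides fail. Elsewhere the admissible factors are bounded and include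
  1, so the greatest one is 1 iff none is at least 2.\<close>

lemma k_content_eq_1_iff:
  fixes B :: "real ^ 'n ^ 'n"
  assumes B: "invertible B" and k: "k \<ge> 1"
  shows "k_content k (range (lattice_point B)) (lattice_point B z) = 1 \<longleftrightarrow> pow_free {p. prime p} k z"
proof (cases "z = 0")
  case True
  have "\<not> pow_free {p. prime p} k z"
    unfolding ex_power_dvd_iff_ex_prime[symmetric] using True by auto
  then show ?thesis
    using True by (simp add: k_content_def)
next
  case False
  define Q where "Q c \<longleftrightarrow> (\<forall>i. int c ^ k dvd z $ i)" for c
  have inj: "lattice_point B a = lattice_point B b \<longleftrightarrow> a = b" for a b
    using inj_lattice_point[OF B] by (simp add: inj_eq)
  then have "lattice_point B z \<noteq> 0"
    using False by (metis lattice_point_zero)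
  moreover have "lattice_point B z \<in> (\<lambda>y. real c ^ k *\<^sub>R y) ` range (lattice_point B) \<longleftrightarrow> Q c" for c
  proof -
    have "real c ^ k *\<^sub>R lattice_point B w = lattice_point B (int c ^ k *s w)" for w
      by (simp add: lattice_point_scale)
    then have "lattice_point B z \<in> (\<lambda>y. real c ^ k *\<^sub>R y) ` range (lattice_point B) \<longleftrightarrow>
        (\<exists>w. lattice_point B z = lattice_point B (int c ^ k *s w))"
      by (simp add: image_iff)
    then show ?thesis
      by (simp only: inj Q_def dvd_vec_iff)
  qed
  ultimately have "k_content k (range (lattice_point B)) (lattice_point B z) = 1 \<longleftrightarrow> (GREATEST c. Q c) = 1"
    by (simp add: k_content_def one_enat_def)
  also have "\<dots> \<longleftrightarrow> \<not> (\<exists>c\<ge>2. Q c)"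
  proof -
    obtain i where i: "z $ i \<noteq> 0"
      using False by (metis vec_eq_iff zero_index)
    \<comment> \<open>\<open>GREATEST\<close> is meaningful only for a bounded predicate; a nonzero
      coordinate provides the bound through \<open>c \<le> c ^ k\<close>.\<close>
    have bound: "c \<le> nat \<bar>z $ i\<bar>" if "Q c" for c
    proof (cases "c = 0")
      case c: False
      have "int c ^ k \<le> \<bar>z $ i\<bar>"
        using dvd_imp_le_int[OF i, of "int c ^ k"] that by (simp add: Q_def)
      moreover have "c \<le> c ^ k"
        using k c by (intro self_le_power) auto
      then have "int c \<le> int c ^ k"
        by (metis of_nat_le_iff of_nat_power)
      ultimately show ?thesis
        by linarith
    qed simp
    have Q1: "Q 1"
      by (simp add: Q_def)
    have Q: "Q (GREATEST c. Q c)"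
      by (rule GreatestI_nat[where P = Q, OF Q1]) (rule bound)
    have le: "c \<le> (GREATEST c. Q c)" if "Q c" for c
      by (rule Greatest_le_nat[where P = Q, OF that]) (rule bound)
    show ?thesis
    proof
      assume "(GREATEST c. Q c) = 1"
      then show "\<not> (\<exists>c\<ge>2. Q c)"
        using le by fastforce
    next
      assume "\<not> (\<exists>c\<ge>2. Q c)"
      then have "(GREATEST c. Q c) < 2"
        using Q by (meson not_le)
      moreover have "(GREATEST c. Q c) \<ge> 1"
        using le[OF Q1] .
      ultimately show "(GREATEST c. Q c) = 1"
        by linarith
    qed
  qed
  also have "\<dots> \<longleftrightarrow> pow_free {p. prime p} k z"
    unfolding Q_def ex_power_dvd_iff_ex_prime by simp
  finally show ?thesis .
qed

lemma k_free_points_eq: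
  assumes "invertible B" "k \<ge> 1"
  shows "k_free_points k (range (lattice_point B)) = lattice_point B ` {z. pow_free {p. prime p} k z}"
proof -
  have "k_free_points k (range (lattice_point B)) =
      lattice_point B ` {z. k_content k (range (lattice_point B)) (lattice_point B z) = 1}"
    unfolding k_free_points_def by blast
  then show ?thesis
    by (simp only: k_content_eq_1_iff[OF assms])
qed

section \<open>Patches in integer coordinates\<close>

lemma patch_eq:
  "patch (lattice_point B ` {z. pow_free F k z}) r (lattice_point B t) =
    lattice_point B ` {z. pow_free F k (t + z) \<and> lattice_point B z \<in> ball 0 r}"
proof -
  have "(\<lambda>x. x - lattice_point B t) ` lattice_point B ` {z. pow_free F k z} =
      lattice_point B ` (\<lambda>z. z - t) ` {z. pow_free F k z}"
    by (simp add: image_image lattice_point_diff)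
  also have "(\<lambda>z. z - t) ` {z. pow_free F k z} = {z. pow_free F k (t + z)}"
  proof (intro equalityI subsetI)
    fix z assume "z \<in> {z. pow_free F k (t + z)}"
    then show "z \<in> (\<lambda>z. z - t) ` {z. pow_free F k z}"
      by (intro image_eqI[of _ _ "t + z"]) auto
  qed auto
  finally have shift: "(\<lambda>x. x - lattice_point B t) ` lattice_point B ` {z. pow_free F k z} =
      lattice_point B ` {z. pow_free F k (t + z)}" .
  show ?thesis
    unfolding patch_def shift by auto
qed

text \<open>Turns a shifted pattern about the origin into a count about the patch centre, where the
  uniform density applies.\<close>

lemma free_count_translate:
  assumes B: "invertible B"
  shows "card {z. pow_free F k (t + z) \<and> lattice_point B z \<in> ball 0 r} = free_count F k B (lattice_point B t) r"
proof -
  have "bij_betw ((+) t) {z. pow_free F k (t + z) \<and> lattice_point B z \<in> ball 0 r}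
      {z. pow_free F k z \<and> lattice_point B z \<in> ball (lattice_point B t) r}"
    by (rule bij_betw_byWitness[where f' = "\<lambda>z. z - t"])
      (auto simp: lattice_point_add lattice_point_diff dist_norm norm_minus_commute)
  then show ?thesis
    unfolding free_count_def by (rule bij_betw_same_card)
qed

context
  fixes B :: "real ^ 'n ^ 'n" and k :: nat and L V :: "(real ^ 'n) set"
  assumes B: "invertible B" and k: "k \<ge> 1" and nk: "CARD('n) * k \<ge> 2"
  defines "L \<equiv> range (lattice_point B)"
    and "V \<equiv> lattice_point B ` {z. pow_free {p. prime p} k z}"
begin

lemma finite_patches: "finite (patch V r ` L)"
proof (rule finite_subset)
  show "patch V r ` L \<subseteq> Pow (lattice_point B ` {z. lattice_point B z \<in> ball 0 r})"
    unfolding L_def V_def by (auto simp: patch_eq)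
  show "finite (Pow (lattice_point B ` {z. lattice_point B z \<in> ball 0 r}))"
    using finite_lattice_ball[OF B, of 0 r] by blast
qed

text \<open>Every set of power-free points in the ball is realised as a patch by
  \<open>pow_free_translate_pattern\<close>, and distinct sets give distinct patches.\<close>

lemma patch_count_ge: "2 ^ free_count {p. prime p} k B 0 r \<le> patch_count L V r"
proof -
  define W where "W = {z. lattice_point B z \<in> ball 0 r}"
  define T where "T = {z\<in>W. pow_free {p. prime p} k z}"
  have W: "finite W"
    unfolding W_def by (rule finite_lattice_ball[OF B])
  have "(`) (lattice_point B) ` Pow T \<subseteq> patch V r ` L"
  proof
    fix X assume "X \<in> (`) (lattice_point B) ` Pow T"
    then obtain A where A: "A \<subseteq> T" "X = lattice_point B ` A"
      by auto
    obtain t where t: "\<And>s. s \<in> W \<Longrightarrow> pow_free {p. prime p} k (t + s) \<longleftrightarrow> s \<in> A"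
      using pow_free_translate_pattern[OF W k nk, of A] A(1) by (auto simp: T_def)
    have "{z. pow_free {p. prime p} k (t + z) \<and> lattice_point B z \<in> ball 0 r} = A"
      using t A(1) unfolding T_def W_def by blast
    then have "patch V r (lattice_point B t) = X"
      unfolding V_def patch_eq A(2) by simp
    then show "X \<in> patch V r ` L"
      unfolding L_def by blast
  qed
  then have "card ((`) (lattice_point B) ` Pow T) \<le> card (patch V r ` L)"
    by (rule card_mono[OF finite_patches])
  moreover have "inj_on ((`) (lattice_point B)) (Pow T)"
    using inj_lattice_point[OF B] by (auto simp: inj_on_def inj_image_eq_iff)
  moreover have "card (Pow T) = 2 ^ card T"
    using W by (intro card_Pow) (simp add: T_def)
  moreover have "card T = free_count {p. prime p} k B 0 r"
    by (simp add: T_def W_def free_count_def conj_commute)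
  ultimately show ?thesis
    by (simp add: card_image patch_count_def)
qed

text \<open>
  A patch lies in the corresponding set for the finitely many primes in \<open>F\<close>, which depends only on
  the residue of the centre modulo \<open>\<Prod>p\<in>F. p\<^sup>k\<close>.
\<close>

lemma patch_count_le:
  assumes F: "finite F" "\<And>p. p \<in> F \<Longrightarrow> prime p"
    and M: "\<And>x. free_count F k B x r \<le> M"
  shows "patch_count L V r \<le> (\<Prod>p\<in>F. p ^ k) ^ CARD('n) * 2 ^ M"
proof -
  define q where "q = (\<Prod>p\<in>F. p ^ k)"
  define G where "G t = lattice_point B ` {z. pow_free F k (t + z) \<and> lattice_point B z \<in> ball 0 r}" for t
  define U where "U = {t :: int ^ 'n. \<forall>i. t $ i \<in> {0..<int q}}"
  have q: "q > 0"
    using F by (auto simp: q_def prime_gt_0_nat intro!: prod_pos)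
  have U: "finite U" "card U = q ^ CARD('n)"
    using card_vec_box[of "\<lambda>_ :: 'n. {0..<int q}"] by (simp_all only: U_def) simp_all
  have finG: "finite {z. pow_free F k (t + z) \<and> lattice_point B z \<in> ball 0 r}" for t
    by (rule finite_subset[OF _ finite_lattice_ball[OF B, of 0 r]]) auto
  have cardG: "card (G t) \<le> M" for t
  proof -
    have "card (G t) \<le> free_count F k B (lattice_point B t) r"
      unfolding G_def free_count_translate[OF B, symmetric] by (rule card_image_le[OF finG])
    then show ?thesis
      using M le_trans by blast
  qed
  have "patch V r ` L \<subseteq> (\<Union>t\<in>U. Pow (G t))"
  proof
    fix X assume "X \<in> patch V r ` L"
    then obtain t where X: "X = lattice_point B ` {z. pow_free {p. prime p} k (t + z) \<and> lattice_point B z \<in> ball 0 r}"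
      unfolding L_def V_def by (auto simp: patch_eq)
    define t' where "t' = (\<chi> i. t $ i mod int q)"
    have "t' \<in> U"
      using q by (simp add: U_def t'_def)
    moreover have "pow_free F k (t' + z)" if "pow_free {p. prime p} k (t + z)" for z
      unfolding pow_free_def
    proof (intro ballI)
      fix p assume p: "p \<in> F"
      have "p ^ k dvd q"
        unfolding q_def using F(1) p by (rule dvd_prodI)
      then have "int p ^ k dvd int q"
        by (metis of_nat_dvd_iff of_nat_power)
      moreover have "int q dvd t' $ i - t $ i" for i
        by (simp add: t'_def flip: mod_eq_dvd_iff)
      ultimately have "int p ^ k dvd t' $ i - t $ i" for i
        by (rule dvd_trans)
      moreover have "(t' + z) $ i = (t' $ i - t $ i) + (t + z) $ i" for i
        by simp
      ultimately have "int p ^ k dvd (t' + z) $ i \<longleftrightarrow> int p ^ k dvd (t + z) $ i" for i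
        by (simp only: dvd_add_right_iff)
      then show "\<not> (\<forall>i. int p ^ k dvd (t' + z) $ i)"
        using that F(2)[OF p] by (auto simp: pow_free_def)
    qed
    then have "X \<subseteq> G t'"
      unfolding X G_def by blast
    ultimately show "X \<in> (\<Union>t\<in>U. Pow (G t))"
      by blast
  qed
  moreover have "finite (\<Union>t\<in>U. Pow (G t))"
    using U(1) finG by (auto simp: G_def)
  ultimately have "patch_count L V r \<le> card (\<Union>t\<in>U. Pow (G t))"
    unfolding patch_count_def by (rule card_mono[rotated])
  also have "\<dots> \<le> (\<Sum>t\<in>U. card (Pow (G t)))"
    by (rule card_UN_le[OF U(1)])
  also have "\<dots> \<le> (\<Sum>t\<in>U. 2 ^ M)"
  proof (rule sum_mono)
    fix t
    have "finite (G t)"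
      using finG by (simp add: G_def)
    then show "card (Pow (G t)) \<le> 2 ^ M"
      using cardG[of t] by (simp add: card_Pow power_increasing)
  qed
  also have "\<dots> = q ^ CARD('n) * 2 ^ M"
    by (simp add: U(2))
  finally show ?thesis
    unfolding q_def .
qed

end

text \<open>The error \<open>e\<close> is spent in quarters: on \<open>D\<close> against the limit,
  on the tail of large primes (lower bound only), on the count in balls, and on the number of
  residue classes (upper bound only). Either way at most three quarters are used.\<close>

proposition patch_rate_tendsto:
  fixes B :: "real ^ 'n ^ 'n"
  assumes B: "invertible B" "\<bar>det B\<bar> = 1" and k: "k \<ge> 1" and nk: "CARD('n) * k \<ge> 2"
  defines "L \<equiv> range (lattice_point B)"
    and "V \<equiv> lattice_point B ` {z. pow_free {p. prime p} k z}"
  shows "(patch_rate L V \<longlongrightarrow> 1 / riemann_zeta (real (CARD('n) * k))) at_top"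
proof (rule tendstoI)
  fix e :: real assume e: "e > 0"
  define n where "n = CARD('n)"
  define v where "v = measure lborel (ball (0 :: real ^ 'n) 1)"
  define h where "h = 1 / riemann_zeta (real (n * k))"
  have v: "v > 0"
    by (simp add: v_def content_ball_pos)
  obtain C where C: "C \<ge> 0"
      "\<And>r. r > 0 \<Longrightarrow> real (card {z. z \<noteq> 0 \<and> lattice_point B z \<in> ball 0 r}) \<le> C * r ^ n"
    using nonzero_lattice_count[OF B(1)] unfolding n_def by blast
  obtain P where P: "P \<ge> 2" "\<bar>free_density (n * k) (primes_upto P) - h\<bar> < e / 4"
    "C * zeta_tail (n * k) P < e / 4 * v"
  proof -
    have "(\<lambda>P. C * zeta_tail (n * k) P) \<longlonglongrightarrow> C * 0"
      using nk by (intro tendsto_mult tendsto_const zeta_tail_tendsto_0) (simp add: n_def)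
    then have "\<forall>\<^sub>F P in sequentially. C * zeta_tail (n * k) P < e / 4 * v"
      by (rule order_tendstoD) (use e v in simp)
    moreover have "(\<lambda>P. free_density (n * k) (primes_upto P)) \<longlonglongrightarrow> h"
      unfolding free_density_def h_def using nk by (intro euler_product) (simp add: n_def)
    then have "\<forall>\<^sub>F P in sequentially. dist (free_density (n * k) (primes_upto P)) h < e / 4"
      by (rule tendstoD) (use e in simp)
    ultimately have "\<forall>\<^sub>F P in sequentially. P \<ge> 2 \<and> \<bar>free_density (n * k) (primes_upto P) - h\<bar> < e / 4 \<and>
        C * zeta_tail (n * k) P < e / 4 * v"
      using eventually_ge_at_top[of 2] by eventually_elim (simp add: dist_real_def)
    then show thesis
      using that by (auto simp: eventually_sequentially)
  qed
  define F where "F = primes_upto P"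
  define D where "D = free_density (n * k) F"
  define q where "q = (\<Prod>p\<in>F. p ^ k)"
  have F: "finite F" "\<And>p. p \<in> F \<Longrightarrow> prime p"
    by (auto simp: F_def primes_upto_def[of P])
  have q: "q > 0"
    using F by (auto simp: q_def prime_gt_0_nat intro!: prod_pos)
  have count: "\<forall>\<^sub>F r in at_top. \<forall>x. \<bar>real (free_count F k B x r) - D * v * r ^ n\<bar> \<le> e / 4 * v * r ^ n"
    using free_count_uniform[OF B F, of "e / 4 * v" k] e v by (simp add: D_def n_def v_def)
  \<comment> \<open>\<open>P\<close>, hence \<open>q\<close>, is fixed before \<open>r\<close>
    grows, so the number of residue classes disappears in the rate.\<close>
  have "filterlim (\<lambda>r :: real. r ^ n) at_top at_top"
    by (intro filterlim_pow_at_top filterlim_ident) (simp add: n_def)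
  then have "((\<lambda>r. log 2 (real (q ^ n)) / r ^ n) \<longlongrightarrow> 0) at_top"
    by (intro tendsto_divide_0[OF tendsto_const] filterlim_at_top_imp_at_infinity)
  then have "\<forall>\<^sub>F r in at_top. log 2 (real (q ^ n)) / r ^ n < e / 4 * v"
    by (rule order_tendstoD) (use e v in simp)
  with count eventually_gt_at_top[of 0]
  show "\<forall>\<^sub>F r in at_top. dist (patch_rate L V r) (1 / riemann_zeta (real (CARD('n) * k))) < e"
    unfolding n_def[symmetric] h_def[symmetric]
  proof eventually_elim
    case (elim r)
    define a where "a = r ^ n"
    have a: "a > 0"
      using elim by (simp add: a_def)
    define N where "N = patch_count L V r"
    have rate: "patch_rate L V r = log 2 (real N) / (a * v)"
      by (simp add: patch_rate_def N_def a_def n_def v_def)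
    define m where "m = free_count {p. prime p} k B 0 r"
    have N_ge: "2 ^ m \<le> N"
      unfolding N_def m_def L_def V_def by (rule patch_count_ge[OF B(1) k nk])
    then have N_pos: "N > 0"
      using less_le_trans[of 0 "2 ^ m" N] by simp
    have "real m \<le> log 2 (real N)"
      using N_ge by (rule le_log2_of_power)
    moreover have "D * v * a - e / 4 * v * a \<le> real (free_count F k B 0 r)"
      using spec[OF elim(1), of 0] unfolding a_def by linarith
    moreover have "real (free_count F k B 0 r) \<le> real m + C * zeta_tail (n * k) P * a"
      using free_count_primes_lower[OF B(1) P(1) nk elim(2) C[unfolded n_def]]
      by (simp add: F_def m_def a_def n_def)
    moreover have "C * zeta_tail (n * k) P * a \<le> e / 4 * v * a"
      using P(3) a by (intro mult_right_mono) auto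
    ultimately have "(D - e / 2) * (a * v) \<le> log 2 (real N)"
      by (simp add: algebra_simps)
    then have lower: "D - e / 2 \<le> patch_rate L V r"
      unfolding rate using a v by (simp add: pos_le_divide_eq)
    define M where "M = nat \<lfloor>D * v * a + e / 4 * v * a\<rfloor>"
    have "free_count F k B x r \<le> M" for x
    proof -
      have "real (free_count F k B x r) \<le> D * v * a + e / 4 * v * a"
        using spec[OF elim(1), of x] unfolding a_def by linarith
      then show ?thesis
        by (simp add: M_def le_nat_floor)
    qed
    then have "N \<le> q ^ n * 2 ^ M"
      unfolding N_def L_def V_def q_def n_def by (intro patch_count_le[OF B(1) k nk] F)
    then have "real N \<le> real (q ^ n) * 2 ^ M"
      using of_nat_mono[of N "q ^ n * 2 ^ M", where 'a = real] by simp
    then have "log 2 (real N) \<le> log 2 (real (q ^ n) * 2 ^ M)"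
      using N_pos by simp
    also have "\<dots> = log 2 (real (q ^ n)) + real M"
      using q by (simp add: log_mult log_nat_power)
    also have "\<dots> < e / 4 * v * a + (D * v * a + e / 4 * v * a)"
    proof (rule add_less_le_mono)
      show "log 2 (real (q ^ n)) < e / 4 * v * a"
        using elim(3) a by (simp add: a_def pos_divide_less_eq)
      \<comment> \<open>\<open>nat\<close> truncates negative values to 0, so \<open>M\<close> is
        below the real bound only once that bound is known to be nonnegative.\<close>
      have "0 \<le> real (free_count F k B 0 r)"
        by simp
      also have "\<dots> \<le> D * v * a + e / 4 * v * a"
        using spec[OF elim(1), of 0] unfolding a_def by linarith
      finally show "real M \<le> D * v * a + e / 4 * v * a"
        unfolding M_def by linarith
    qed
    finally have "log 2 (real N) \<le> (D + e / 2) * (a * v)"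
      by (simp add: algebra_simps)
    then have upper: "patch_rate L V r \<le> D + e / 2"
      unfolding rate using a v by (simp add: pos_divide_le_eq)
    show "dist (patch_rate L V r) h < e"
      using lower upper P(2) e unfolding D_def F_def dist_real_def by linarith
  qed
qed

section \<open>From a basis of determinant \<plusminus>1 to the lattice\<close>

theorem theorem3:
  fixes \<Lambda> V :: "(real ^ 'n) set" and k :: nat
  assumes "is_lattice \<Lambda>" and "lattice_det \<Lambda> = 1"
    and "k \<ge> 1" and "CARD('n) = 1 \<Longrightarrow> k \<ge> 2"
    and "V = k_free_points k \<Lambda>"
  shows "(patch_rate \<Lambda> V \<longlongrightarrow> pc_entropy \<Lambda> V) at_top \<and>
         pc_entropy \<Lambda> V = 1 / riemann_zeta (real (CARD('n) * k))"
proof -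
  obtain B where basis: "lattice_basis B \<Lambda>"
    using assms(1) by (auto simp: is_lattice_def)
  then have B: "invertible B" "\<bar>det B\<bar> = 1"
    using lattice_det_eq[OF basis] assms(2) by (auto simp: lattice_basis_def)
  have \<Lambda>: "\<Lambda> = range (lattice_point B)"
    by (rule lattice_basis_range[OF basis])
  have V: "V = lattice_point B ` {z. pow_free {p. prime p} k z}"
    using k_free_points_eq[OF B(1) assms(3)] assms(5) \<Lambda> by simp
  \<comment> \<open>This is where dimension one demands \<open>k \<ge> 2\<close>: the zeta series
    converges only for exponents above 1.\<close>
  have nk: "CARD('n) * k \<ge> 2"
  proof (cases "CARD('n) = 1")
    case False
    then have "CARD('n) \<ge> 2"
      using zero_less_card_finite[where 'a = 'n] by linarith
    then show ?thesis
      using mult_le_mono[of 2 "CARD('n)" 1 k] assms(3) by simp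
  qed (use assms(4) in simp)
  \<comment> \<open>\<open>Lim\<close> determines a value only when the limit exists, so convergence
    comes first.\<close>
  have lim: "(patch_rate \<Lambda> V \<longlongrightarrow> 1 / riemann_zeta (real (CARD('n) * k))) at_top"
    unfolding \<Lambda> V by (rule patch_rate_tendsto[OF B assms(3) nk])
  then have "pc_entropy \<Lambda> V = 1 / riemann_zeta (real (CARD('n) * k))"
    unfolding pc_entropy_def by (rule tendsto_Lim[rotated]) simp
  with lim show ?thesis
    by simp
qed

end
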